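(* Let $\{x_k\}$ be an infinite sequence generated by the SQP-type algorithm described in the context, under Assumption A, with penalty parameters $\{\rho_k\}$. Suppose that $\lim_{k\to\infty}\rho_k=0$ and $\lim_{k\to\infty}v_k>0$, and let $\mathcal K_\rho:=\{k\mid\rho_{k+1}<\rho_k\}$. Then every accumulation point $x^*$ of the subsequence $\{x_k\}_{k\in\mathcal K_\rho}$ is an infeasible stationary point of the problem (P): minimize $f(x)$ subject to $h(x)=0$, $G(x)\preceq0$. Furthermore, $x^*$ is a Fritz-John point of the shifted problem: minimize $f(x)$ subject to $h(x)=r^*-s^*$, $G(x)\preceq t^*I_m$, where $(r^*,s^*,t^* )$ is the least shift associated with $x^*$ (defined in the context), and Robinson's constraint qualification for this shifted problem fails at $x^*$.
   Context: Notation. $\mathcal S^m$ is the space of real symmetric $m\times m$ matrices, $\langle A,B\rangle=\mathrm{tr}(AB)$, $\preceq,\prec$ are in the Loewner sense, $\lambda_1(A)$ is the largest eigenvalue of $A$, $[a]_+=\max\{0,a\}$ and $[a]_-=\min\{0,a\}$ (componentwise for vectors), $\circ$ is the componentwise product, $e_l=(1,\dots,1)^T\in\mathbb R^l$, $I_m$ is the identity. Data: $f:\mathbb R^n\to\mathbb R$, $h:\mathbb R^n\to\mathbb R^l$, $G:\mathbb R^n\to\mathcal S^m$; $g=\nabla f$; $Dh(x)$ is the Jacobian of $h$; $DG(x)d=\sum_i d_i\,\partial G(x)/\partial x_i$; $DG(x)^*Y=(\langle\partial G(x)/\partial x_1,Y\rangle,\dots,\langle\partial G(x)/\partial x_n,Y\rangle)^T$.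 Subscript $k$ means evaluation at $x_k$ ($f_k,g_k,h_k,G_k,v_k$). Constraint violation: $v(x)=\|h(x)\|_1+[\lambda_1(G(x))]_+$. An infeasible stationary point of (P) is a point $x$ with $v(x)>0$ that is first-order optimal for $\min_xv(x)$, i.e. for some $(\mu,Y)\in\mathbb R^l\times\mathcal S^m$: $Dh(x)^T\mu+DG(x)^*Y=0$; $(e_l-\mu)\circ[h(x)]_+=0$; $(e_l+\mu)\circ[h(x)]_-=0$; $(1-\mathrm{tr}(Y))[\lambda_1(G(x))]_+=0$; $\langle Y,G(x)-[\lambda_1(G(x))]_+I_m\rangle=0$; $-e_l\le\mu\le e_l$, $Y\succeq0$, $\mathrm{tr}(Y)\le1$. The least shift associated with $x^*$ is $(r^*,s^*,t^* )=([h(x^* )]_+,-[h(x^* )]_-,[\lambda_1(G(x^* ))]_+)$; it minimizes $e_l^T(r+s)+t$ over $r,s,t\ge0$ with $h(x^* )=r-s$, $G(x^* )\preceq tI_m$. A point $x$ is a Fritz-John point of the shifted problem (minimize $f$ s.t. $h(x)=r^*-s^*$, $G(x)\preceq t^*I_m$) if for some $(\rho,\mu,Y)\neq0$, $\rho\ge0$: $\rho g(x)+Dh(x)^T\mu+DG(x)^*Y=0$, $h(x)=r^*-s^*$, $G(x)\preceq t^*I_m$, $\langle Y,G(x)-t^*I_m\rangle=0$, $Y\succeq0$. Robinson's constraint qualification for the shifted problem holds at a feasible point $x^*$ of it iff $Dh(x^* )$ has full row rank and there is a unit vector $\bar d\in\mathbb R^n$ with $Dh(x^* )\bar d=0$ and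 $G(x^* )+DG(x^* )\bar d\prec t^*I_m$. Penalty function: $P^\rho(x)=\rho f(x)+v(x)$. Linearizations at $x_k$: $l_k^v(d)=\|h_k+Dh(x_k)d\|_1+[\lambda_1(G_k+DG(x_k)d)]_+$, $\Delta l_k^v(d)=l_k^v(0)-l_k^v(d)$, $\Delta l_k^\rho(d)=-\rho g_k^Td+\Delta l_k^v(d)$. Algorithm. Constants $\epsilon,\delta,\eta,\gamma\in(0,1)$, start $x_0\in\mathbb R^n$, $\rho_0>0$; positive definite matrices $B_k^{fea},B_k\in\mathcal S^n$ are given at each iteration. Iteration $k$: (1) Solve $\min_{d,r,s,t}\ e_l^T(r+s)+t+\frac12d^TB_k^{fea}d$ s.t. $h_k+Dh(x_k)d=r-s$, $G_k+DG(x_k)d\preceq tI_m$, $r\ge0,s\ge0,t\ge0$ ($r,s\in\mathbb R^l$, $t\in\mathbb R$), giving $(d_k^{fea},r_k,s_k,t_k)$ and Lagrange multipliers $(\bar\mu_{k+1},\bar Y_{k+1})\in\mathbb R^l\times\mathcal S^m$ for the equality and semidefinite constraints (Lagrangian: objective $+\mu^T(h_k+Dh(x_k)d-r+s)+\langle Y,G_k+DG(x_k)d-tI_m\rangle-\nu_r^Tr-\nu_s^Ts-\nu_tt$, with $Y\succeq0$ and $\nu_r,\nu_s,\nu_t\ge0$). (2) Solve $\min_d\ \rho_kg_k^Td+\frac12d^TB_kd$ s.t. $h_k+Dh(x_k)d=r_k-s_k$, $G_k+DG(x_k)d\preceq t_kI_m$, giving $d_k$ and Lagrange multipliers $(\hat\mu_{k+1},\hat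 Y_{k+1})$ ($\hat Y_{k+1}\succeq0$), which are taken to exist. (3) If $d_k=0$, stop. (4) If $\rho_k(\|\bar\mu_{k+1}\|_\infty+\mathrm{tr}(\bar Y_{k+1}))>1$ or $\rho_k(\|\hat\mu_{k+1}\|_\infty+\mathrm{tr}(\hat Y_{k+1}))>1$, set $\rho_k'=\min\{\delta\rho_k,(1-\epsilon)/(\|\bar\mu_{k+1}\|_\infty+\mathrm{tr}(\bar Y_{k+1})+\|\hat\mu_{k+1}\|_\infty+\mathrm{tr}(\hat Y_{k+1}))\}$; otherwise $\rho_k'=\rho_k$. If $\Delta l_k^{\rho_k'}(d_k)<\epsilon\Delta l_k^v(d_k)$, set $\rho_{k+1}=\min\{\delta\rho_k',\zeta_k\}$ with $\zeta_k=(1-\epsilon)\Delta l_k^v(d_k)/(g_k^Td_k+\frac12d_k^TB_kd_k)$; otherwise $\rho_{k+1}=\rho_k'$. (5) Let $\alpha_k$ be the first $\alpha\in\{1,\gamma,\gamma^2,\dots\}$ with $P^{\rho_{k+1}}(x_k+\alpha d_k)-P^{\rho_{k+1}}(x_k)\le-\eta\alpha\Delta l_k^{\rho_{k+1}}(d_k)$; set $x_{k+1}=x_k+\alpha_kd_k$. (No cap on the number of iterations.) Assumption A. (A1) $f,h,G$ are twice continuously differentiable. (A2) There is a convex compact set $\Omega\subseteq\mathbb R^n$ with $x_k\in\Omega$ for all $k$. (A3) There are constants $0<b_1<b_2$ with $b_1\|d\|^2\le d^TB_k^{fea}d\le b_2\|d\|^2$ and $b_1\|d\|^2\le d^TB_kd\le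 b_2\|d\|^2$ for all $k$ and $d\in\mathbb R^n$. *)

theory Defs
  imports "HOL-Analysis.Analysis"
begin

definition symmetric :: "real^'m^'m \<Rightarrow> bool" where
  "symmetric A \<longleftrightarrow> transpose A = A"

definition mat_inner :: "real^'m^'m \<Rightarrow> real^'m^'m \<Rightarrow> real" where
  "mat_inner A B = trace (A ** B)"

definition pos_semidef :: "real^'m^'m \<Rightarrow> bool" where
  "pos_semidef A \<longleftrightarrow> symmetric A \<and> (\<forall>w. 0 \<le> w \<bullet> (A *v w))"

definition pos_def :: "real^'m^'m \<Rightarrow> bool" where
  "pos_def A \<longleftrightarrow> symmetric A \<and> (\<forall>w. w \<noteq> 0 \<longrightarrow> 0 < w \<bullet> (A *v w))"

definition loewner_le :: "real^'m^'m \<Rightarrow> real^'m^'m \<Rightarrow> bool"  (infix "\<preceq>\<^sub>L" 50) where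
  "A \<preceq>\<^sub>L B \<longleftrightarrow> pos_semidef (B - A)"

definition loewner_less :: "real^'m^'m \<Rightarrow> real^'m^'m \<Rightarrow> bool"  (infix "\<prec>\<^sub>L" 50) where
  "A \<prec>\<^sub>L B \<longleftrightarrow> pos_def (B - A)"

text \<open>Only meaningful for symmetric \<open>A\<close>, where the set of eigenvalues is finite and nonempty.\<close>

definition max_eigenvalue :: "real^'m^'m \<Rightarrow> real" where
  "max_eigenvalue A = Max {c. \<exists>w. w \<noteq> 0 \<and> A *v w = c *\<^sub>R w}"

text \<open>
  On \<^typ>\<open>real^'l\<close> the library order \<open>\<le>\<close> and the product \<open>*\<close> are componentwise, \<open>1\<close> is the
  all-ones vector and \<^const>\<open>infnorm\<close> is the maximum norm.
\<close>

definition pos_part :: "real^'l \<Rightarrow> real^'l" where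
  "pos_part a = (\<chi> i. max 0 (a $ i))"

definition neg_part :: "real^'l \<Rightarrow> real^'l" where
  "neg_part a = (\<chi> i. min 0 (a $ i))"

definition l1_norm :: "real^'l \<Rightarrow> real" where
  "l1_norm a = (\<Sum>i\<in>UNIV. \<bar>a $ i\<bar>)"

definition twice_cont_diff :: "('a::real_normed_vector \<Rightarrow> 'b::real_normed_vector) \<Rightarrow> bool" where
  "twice_cont_diff F \<longleftrightarrow>
     (\<exists>(F' :: 'a \<Rightarrow> 'a \<Rightarrow>\<^sub>L 'b) (F'' :: 'a \<Rightarrow> 'a \<Rightarrow>\<^sub>L 'a \<Rightarrow>\<^sub>L 'b).
        (\<forall>x. (F has_derivative blinfun_apply (F' x)) (at x)) \<and>
        (\<forall>x. (F' has_derivative blinfun_apply (F'' x)) (at x)) \<and>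
        continuous_on UNIV F'')"

definition partial_deriv :: "(real^'n \<Rightarrow> 'b::real_normed_vector) \<Rightarrow> 'n \<Rightarrow> real^'n \<Rightarrow> 'b" where
  "partial_deriv F i x = vector_derivative (\<lambda>\<tau>. F (x + \<tau> *\<^sub>R axis i 1)) (at 0)"

definition grad :: "(real^'n \<Rightarrow> real) \<Rightarrow> real^'n \<Rightarrow> real^'n" where
  "grad f x = (\<chi> i. partial_deriv f i x)"

abbreviation Dh :: "(real^'n \<Rightarrow> real^'l) \<Rightarrow> real^'n \<Rightarrow> real^'n^'l" where
  "Dh h x \<equiv> jacobian h (at x)"

definition DG :: "(real^'n \<Rightarrow> real^'m^'m) \<Rightarrow> real^'n \<Rightarrow> real^'n \<Rightarrow> real^'m^'m" where
  "DG G x d = (\<Sum>i\<in>UNIV. (d $ i) *\<^sub>R partial_deriv G i x)"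

definition DG_adj :: "(real^'n \<Rightarrow> real^'m^'m) \<Rightarrow> real^'n \<Rightarrow> real^'m^'m \<Rightarrow> real^'n" where
  "DG_adj G x Y = (\<chi> i. mat_inner (partial_deriv G i x) Y)"

definition violation :: "(real^'n \<Rightarrow> real^'l) \<Rightarrow> (real^'n \<Rightarrow> real^'m^'m) \<Rightarrow> real^'n \<Rightarrow> real" where
  "violation h G x = l1_norm (h x) + max 0 (max_eigenvalue (G x))"

definition infeasible_stationary ::
  "(real^'n \<Rightarrow> real^'l) \<Rightarrow> (real^'n \<Rightarrow> real^'m^'m) \<Rightarrow> real^'n \<Rightarrow> bool" where
  "infeasible_stationary h G x \<longleftrightarrow>
     violation h G x > 0 \<and>
     (\<exists>\<mu> Y. transpose (Dh h x) *v \<mu> + DG_adj G x Y = 0 \<and>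
        (1 - \<mu>) * pos_part (h x) = 0 \<and>
        (1 + \<mu>) * neg_part (h x) = 0 \<and>
        (1 - trace Y) * max 0 (max_eigenvalue (G x)) = 0 \<and>
        mat_inner Y (G x - max 0 (max_eigenvalue (G x)) *\<^sub>R mat 1) = 0 \<and>
        - 1 \<le> \<mu> \<and> \<mu> \<le> 1 \<and> pos_semidef Y \<and> trace Y \<le> 1)"

definition least_shift ::
  "(real^'n \<Rightarrow> real^'l) \<Rightarrow> (real^'n \<Rightarrow> real^'m^'m) \<Rightarrow> real^'n \<Rightarrow> (real^'l) \<times> (real^'l) \<times> real" where
  "least_shift h G x = (pos_part (h x), - neg_part (h x), max 0 (max_eigenvalue (G x)))"

text \<open>Shifted problem: minimize \<open>f x\<close> subject to \<open>h x = r - s\<close> and \<open>G x \<preceq> t I\<close>.\<close>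

definition fritz_john_shifted ::
  "(real^'n \<Rightarrow> real) \<Rightarrow> (real^'n \<Rightarrow> real^'l) \<Rightarrow> (real^'n \<Rightarrow> real^'m^'m) \<Rightarrow>
   (real^'l) \<times> (real^'l) \<times> real \<Rightarrow> real^'n \<Rightarrow> bool" where
  "fritz_john_shifted f h G = (\<lambda>(r, s, t) x.
     \<exists>\<rho> \<mu> Y. (\<rho>, \<mu>, Y) \<noteq> (0, 0, 0) \<and> 0 \<le> \<rho> \<and>
       \<rho> *\<^sub>R grad f x + transpose (Dh h x) *v \<mu> + DG_adj G x Y = 0 \<and>
       h x = r - s \<and> G x \<preceq>\<^sub>L t *\<^sub>R mat 1 \<and>
       mat_inner Y (G x - t *\<^sub>R mat 1) = 0 \<and> pos_semidef Y)"

text \<open>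
  Robinson's constraint qualification for the shifted problem at a feasible point. Feasibility of
  \<open>x\<close> is not a conjunct, so that the negation can only mean that the qualification fails.
\<close>

definition robinson_cq_shifted ::
  "(real^'n \<Rightarrow> real^'l) \<Rightarrow> (real^'n \<Rightarrow> real^'m^'m) \<Rightarrow>
   (real^'l) \<times> (real^'l) \<times> real \<Rightarrow> real^'n \<Rightarrow> bool" where
  "robinson_cq_shifted h G = (\<lambda>(r, s, t) x.
     rank (Dh h x :: real^'n^'l) = CARD('l) \<and>
     (\<exists>d. norm d = 1 \<and> Dh h x *v d = 0 \<and> G x + DG G x d \<prec>\<^sub>L t *\<^sub>R mat 1))"

definition penalty ::
  "(real^'n \<Rightarrow> real) \<Rightarrow> (real^'n \<Rightarrow> real^'l) \<Rightarrow> (real^'n \<Rightarrow> real^'m^'m) \<Rightarrow>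
   real \<Rightarrow> real^'n \<Rightarrow> real" where
  "penalty f h G \<rho> x = \<rho> * f x + violation h G x"

definition lin_violation ::
  "(real^'n \<Rightarrow> real^'l) \<Rightarrow> (real^'n \<Rightarrow> real^'m^'m) \<Rightarrow> real^'n \<Rightarrow> real^'n \<Rightarrow> real" where
  "lin_violation h G x d =
     l1_norm (h x + Dh h x *v d) + max 0 (max_eigenvalue (G x + DG G x d))"

definition violation_decrease ::
  "(real^'n \<Rightarrow> real^'l) \<Rightarrow> (real^'n \<Rightarrow> real^'m^'m) \<Rightarrow> real^'n \<Rightarrow> real^'n \<Rightarrow> real" where
  "violation_decrease h G x d = lin_violation h G x 0 - lin_violation h G x d"

definition penalty_decrease ::
  "(real^'n \<Rightarrow> real) \<Rightarrow> (real^'n \<Rightarrow> real^'l) \<Rightarrow> (real^'n \<Rightarrow> real^'m^'m) \<Rightarrow>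
   real \<Rightarrow> real^'n \<Rightarrow> real^'n \<Rightarrow> real" where
  "penalty_decrease f h G \<rho> x d = - \<rho> * (grad f x \<bullet> d) + violation_decrease h G x d"

definition fea_feasible ::
  "(real^'n \<Rightarrow> real^'l) \<Rightarrow> (real^'n \<Rightarrow> real^'m^'m) \<Rightarrow> real^'n \<Rightarrow>
   (real^'n) \<times> (real^'l) \<times> (real^'l) \<times> real \<Rightarrow> bool" where
  "fea_feasible h G x = (\<lambda>(d, r, s, t).
     h x + Dh h x *v d = r - s \<and> G x + DG G x d \<preceq>\<^sub>L t *\<^sub>R mat 1 \<and>
     0 \<le> r \<and> 0 \<le> s \<and> 0 \<le> t)"

definition fea_objective ::
  "real^'n^'n \<Rightarrow> (real^'n) \<times> (real^'l) \<times> (real^'l) \<times> real \<Rightarrow> real" where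
  "fea_objective B = (\<lambda>(d, r, s, t). 1 \<bullet> (r + s) + t + 1/2 * (d \<bullet> (B *v d)))"

definition fea_lagrangian ::
  "(real^'n \<Rightarrow> real^'l) \<Rightarrow> (real^'n \<Rightarrow> real^'m^'m) \<Rightarrow> real^'n \<Rightarrow> real^'n^'n \<Rightarrow>
   real^'l \<Rightarrow> real^'m^'m \<Rightarrow> real^'l \<Rightarrow> real^'l \<Rightarrow> real \<Rightarrow>
   (real^'n) \<times> (real^'l) \<times> (real^'l) \<times> real \<Rightarrow> real" where
  "fea_lagrangian h G x B \<mu> Y \<nu>r \<nu>s \<nu>t = (\<lambda>(d, r, s, t).
     fea_objective B (d, r, s, t)
     + \<mu> \<bullet> (h x + Dh h x *v d - r + s)
     + mat_inner Y (G x + DG G x d - t *\<^sub>R mat 1)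
     - \<nu>r \<bullet> r - \<nu>s \<bullet> s - \<nu>t * t)"

definition fea_solution ::
  "(real^'n \<Rightarrow> real^'l) \<Rightarrow> (real^'n \<Rightarrow> real^'m^'m) \<Rightarrow> real^'n \<Rightarrow> real^'n^'n \<Rightarrow>
   (real^'n) \<times> (real^'l) \<times> (real^'l) \<times> real \<Rightarrow> bool" where
  "fea_solution h G x B z \<longleftrightarrow>
     fea_feasible h G x z \<and>
     (\<forall>z'. fea_feasible h G x z' \<longrightarrow> fea_objective B z \<le> fea_objective B z')"

definition fea_multipliers ::
  "(real^'n \<Rightarrow> real^'l) \<Rightarrow> (real^'n \<Rightarrow> real^'m^'m) \<Rightarrow> real^'n \<Rightarrow> real^'n^'n \<Rightarrow>
   (real^'n) \<times> (real^'l) \<times> (real^'l) \<times> real \<Rightarrow> real^'l \<Rightarrow> real^'m^'m \<Rightarrow> bool" where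
  "fea_multipliers h G x B = (\<lambda>(d, r, s, t) \<mu> Y.
     pos_semidef Y \<and>
     mat_inner Y (G x + DG G x d - t *\<^sub>R mat 1) = 0 \<and>
     (\<exists>\<nu>r \<nu>s \<nu>t. 0 \<le> \<nu>r \<and> 0 \<le> \<nu>s \<and> 0 \<le> \<nu>t \<and>
        \<nu>r \<bullet> r = 0 \<and> \<nu>s \<bullet> s = 0 \<and> \<nu>t * t = 0 \<and>
        (fea_lagrangian h G x B \<mu> Y \<nu>r \<nu>s \<nu>t has_derivative (\<lambda>_. 0)) (at (d, r, s, t))))"

definition opt_feasible ::
  "(real^'n \<Rightarrow> real^'l) \<Rightarrow> (real^'n \<Rightarrow> real^'m^'m) \<Rightarrow> real^'n \<Rightarrow>
   real^'l \<Rightarrow> real^'l \<Rightarrow> real \<Rightarrow> real^'n \<Rightarrow> bool" where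
  "opt_feasible h G x r s t d \<longleftrightarrow>
     h x + Dh h x *v d = r - s \<and> G x + DG G x d \<preceq>\<^sub>L t *\<^sub>R mat 1"

definition opt_objective ::
  "(real^'n \<Rightarrow> real) \<Rightarrow> real^'n \<Rightarrow> real \<Rightarrow> real^'n^'n \<Rightarrow> real^'n \<Rightarrow> real" where
  "opt_objective f x \<rho> B d = \<rho> * (grad f x \<bullet> d) + 1/2 * (d \<bullet> (B *v d))"

definition opt_lagrangian ::
  "(real^'n \<Rightarrow> real) \<Rightarrow> (real^'n \<Rightarrow> real^'l) \<Rightarrow> (real^'n \<Rightarrow> real^'m^'m) \<Rightarrow> real^'n \<Rightarrow> real \<Rightarrow>
   real^'n^'n \<Rightarrow> real^'l \<Rightarrow> real^'l \<Rightarrow> real \<Rightarrow> real^'l \<Rightarrow> real^'m^'m \<Rightarrow> real^'n \<Rightarrow> real" where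
  "opt_lagrangian f h G x \<rho> B r s t \<mu> Y d =
     opt_objective f x \<rho> B d
     + \<mu> \<bullet> (h x + Dh h x *v d - r + s)
     + mat_inner Y (G x + DG G x d - t *\<^sub>R mat 1)"

definition opt_solution ::
  "(real^'n \<Rightarrow> real) \<Rightarrow> (real^'n \<Rightarrow> real^'l) \<Rightarrow> (real^'n \<Rightarrow> real^'m^'m) \<Rightarrow> real^'n \<Rightarrow> real \<Rightarrow>
   real^'n^'n \<Rightarrow> real^'l \<Rightarrow> real^'l \<Rightarrow> real \<Rightarrow> real^'n \<Rightarrow> bool" where
  "opt_solution f h G x \<rho> B r s t d \<longleftrightarrow>
     opt_feasible h G x r s t d \<and>
     (\<forall>d'. opt_feasible h G x r s t d' \<longrightarrow> opt_objective f x \<rho> B d \<le> opt_objective f x \<rho> B d')"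

definition opt_multipliers ::
  "(real^'n \<Rightarrow> real) \<Rightarrow> (real^'n \<Rightarrow> real^'l) \<Rightarrow> (real^'n \<Rightarrow> real^'m^'m) \<Rightarrow> real^'n \<Rightarrow> real \<Rightarrow>
   real^'n^'n \<Rightarrow> real^'l \<Rightarrow> real^'l \<Rightarrow> real \<Rightarrow> real^'n \<Rightarrow> real^'l \<Rightarrow> real^'m^'m \<Rightarrow> bool" where
  "opt_multipliers f h G x \<rho> B r s t d \<mu> Y \<longleftrightarrow>
     pos_semidef Y \<and>
     mat_inner Y (G x + DG G x d - t *\<^sub>R mat 1) = 0 \<and>
     (opt_lagrangian f h G x \<rho> B r s t \<mu> Y has_derivative (\<lambda>_. 0)) (at d)"

definition mult_size :: "real^'l \<Rightarrow> real^'m^'m \<Rightarrow> real" where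
  "mult_size \<mu> Y = infnorm \<mu> + trace Y"

text \<open>The update \<open>\<rho> \<mapsto> \<rho>'\<close>; \<open>\<sigma>\<close> and \<open>\<sigma>'\<close> are the sizes of the two pairs of multipliers.\<close>

definition multiplier_update :: "real \<Rightarrow> real \<Rightarrow> real \<Rightarrow> real \<Rightarrow> real \<Rightarrow> real" where
  "multiplier_update \<epsilon> \<delta> \<rho> \<sigma> \<sigma>' =
     (if \<rho> * \<sigma> > 1 \<or> \<rho> * \<sigma>' > 1 then min (\<delta> * \<rho>) ((1 - \<epsilon>) / (\<sigma> + \<sigma>')) else \<rho>)"

definition decrease_update ::
  "(real^'n \<Rightarrow> real) \<Rightarrow> (real^'n \<Rightarrow> real^'l) \<Rightarrow> (real^'n \<Rightarrow> real^'m^'m) \<Rightarrow>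
   real \<Rightarrow> real \<Rightarrow> real^'n \<Rightarrow> real^'n^'n \<Rightarrow> real^'n \<Rightarrow> real \<Rightarrow> real" where
  "decrease_update f h G \<epsilon> \<delta> x B d \<rho>' =
     (if penalty_decrease f h G \<rho>' x d < \<epsilon> * violation_decrease h G x d
      then min (\<delta> * \<rho>')
             ((1 - \<epsilon>) * violation_decrease h G x d / (grad f x \<bullet> d + 1/2 * (d \<bullet> (B *v d))))
      else \<rho>')"

definition sufficient_decrease ::
  "(real^'n \<Rightarrow> real) \<Rightarrow> (real^'n \<Rightarrow> real^'l) \<Rightarrow> (real^'n \<Rightarrow> real^'m^'m) \<Rightarrow>
   real \<Rightarrow> real \<Rightarrow> real^'n \<Rightarrow> real^'n \<Rightarrow> real \<Rightarrow> bool" where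
  "sufficient_decrease f h G \<eta> \<rho> x d \<alpha> \<longleftrightarrow>
     penalty f h G \<rho> (x + \<alpha> *\<^sub>R d) - penalty f h G \<rho> x \<le> - \<eta> * \<alpha> * penalty_decrease f h G \<rho> x d"

text \<open>
  \<open>\<mu>b\<close>, \<open>Yb\<close> are the multipliers of the feasibility subproblem and \<open>\<mu>h\<close>, \<open>Yh\<close> those of the
  optimality subproblem; the ones computed in iteration \<open>k\<close> carry the index \<open>k + 1\<close>, and their
  values at \<open>0\<close> are irrelevant. As the run never stops, every \<open>d k\<close> is nonzero.
\<close>

definition sqp_run ::
  "(real^'n \<Rightarrow> real) \<Rightarrow> (real^'n \<Rightarrow> real^'l) \<Rightarrow> (real^'n \<Rightarrow> real^'m^'m) \<Rightarrow>
   real \<Rightarrow> real \<Rightarrow> real \<Rightarrow> real \<Rightarrow>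
   (nat \<Rightarrow> real^'n^'n) \<Rightarrow> (nat \<Rightarrow> real^'n^'n) \<Rightarrow>
   (nat \<Rightarrow> real^'n) \<Rightarrow> (nat \<Rightarrow> real) \<Rightarrow>
   (nat \<Rightarrow> real^'n) \<Rightarrow> (nat \<Rightarrow> real^'l) \<Rightarrow> (nat \<Rightarrow> real^'l) \<Rightarrow> (nat \<Rightarrow> real) \<Rightarrow>
   (nat \<Rightarrow> real^'l) \<Rightarrow> (nat \<Rightarrow> real^'m^'m) \<Rightarrow>
   (nat \<Rightarrow> real^'n) \<Rightarrow> (nat \<Rightarrow> real^'l) \<Rightarrow> (nat \<Rightarrow> real^'m^'m) \<Rightarrow> bool" where
  "sqp_run f h G \<epsilon> \<delta> \<eta> \<gamma> Bfea B x \<rho> dfea r s t \<mu>b Yb d \<mu>h Yh \<longleftrightarrow>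
     \<rho> 0 > 0 \<and>
     (\<forall>k. pos_def (Bfea k) \<and> pos_def (B k) \<and>
        fea_solution h G (x k) (Bfea k) (dfea k, r k, s k, t k) \<and>
        fea_multipliers h G (x k) (Bfea k) (dfea k, r k, s k, t k) (\<mu>b (Suc k)) (Yb (Suc k)) \<and>
        opt_solution f h G (x k) (\<rho> k) (B k) (r k) (s k) (t k) (d k) \<and>
        opt_multipliers f h G (x k) (\<rho> k) (B k) (r k) (s k) (t k) (d k)
          (\<mu>h (Suc k)) (Yh (Suc k)) \<and>
        d k \<noteq> 0 \<and>
        \<rho> (Suc k) = decrease_update f h G \<epsilon> \<delta> (x k) (B k) (d k)
          (multiplier_update \<epsilon> \<delta> (\<rho> k)
             (mult_size (\<mu>b (Suc k)) (Yb (Suc k))) (mult_size (\<mu>h (Suc k)) (Yh (Suc k)))) \<and>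
        (\<exists>j. sufficient_decrease f h G \<eta> (\<rho> (Suc k)) (x k) (d k) (\<gamma> ^ j) \<and>
             (\<forall>i<j. \<not> sufficient_decrease f h G \<eta> (\<rho> (Suc k)) (x k) (d k) (\<gamma> ^ i)) \<and>
             x (Suc k) = x k + (\<gamma> ^ j) *\<^sub>R d k))"

end

theory Submission
  imports Defs
begin

text \<open>
  Everything follows from one fact: the feasibility steps \<open>dfea\<close> tend to zero along \<open>\<phi>\<close>.

  Why they do. The second subproblem keeps the shift found by the first one, so the predicted
  decrease of the violation along \<open>d k\<close> is at least the quadratic term of the first subproblem, hence
  at least a multiple of the square of \<open>norm (dfea k)\<close> (\<open>violation_decrease_ge\<close>). The update of the
  penalty parameter makes the predicted decrease of the penalty function at least \<open>\<epsilon>\<close> times as large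
  (\<open>decrease_update_properties\<close>). By the line search, step length times predicted decrease is at most
  a constant times the actual decrease of the penalty function. Since \<open>\<rho>\<close> tends to zero and \<open>f\<close> is
  bounded on \<open>\<Omega>\<close>, this decrease is asymptotically the difference of two consecutive violations and
  tends to zero. Finally, as long as the predicted decrease stays away from zero, so do the step
  lengths, because near \<open>xstar\<close> all short steps are accepted (\<open>short_steps_accepted\<close>). So the predicted
  decrease itself tends to zero, and \<open>dfea\<close> with it.

  Why this is enough. The multipliers of the first subproblem are bounded because of the sign
  constraints on the shift, so its KKT conditions have a limit, with step \<open>0\<close>. These limit conditions
  are exactly stationarity of the violation
  (\<open>vanishing_feasibility_steps_imp_infeasible_stationary\<close>). As the limit violation is
  positive, the multipliers \<open>(\<mu>, Y)\<close> obtained do not vanish. Together with multiplier \<open>0\<close> for the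
  objective they give the Fritz John condition, and pairing them with a direction as in Robinson's
  qualification gives a contradiction.

  The matrix part rests on two tools. A positive semidefinite matrix is a finite sum of matrices
  \<open>v v\<^sup>T\<close>, which makes the trace pairing of two such matrices nonnegative. The largest eigenvalue is
  the maximum of the quadratic form on the unit sphere, which makes it convex and Lipschitz.
\<close>

section \<open>Positive semidefinite matrices\<close>

lemma inner_symmetric_swap:
  assumes "symmetric A"
  shows "u \<bullet> (A *v w) = w \<bullet> (A *v u)"
  using assms by (metis dot_lmul_matrix inner_commute symmetric_def transpose_matrix_vector)

lemma symmetric_add: "symmetric A \<Longrightarrow> symmetric B \<Longrightarrow> symmetric (A + B)"
  and symmetric_diff: "symmetric A \<Longrightarrow> symmetric B \<Longrightarrow> symmetric (A - B)"
  and symmetric_scaleR: "symmetric A \<Longrightarrow> symmetric (c *\<^sub>R A)"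
  and symmetric_mat: "symmetric (mat c)"
  by (auto simp: symmetric_def transpose_def vec_eq_iff mat_def)

lemma symmetric_nth: "symmetric A \<Longrightarrow> A $ i $ j = A $ j $ i"
  by (auto simp: symmetric_def transpose_def vec_eq_iff)

lemma scaleR_mat_1_vector: "(c *\<^sub>R mat 1 :: real^'m^'m) *v w = c *\<^sub>R w"
  by (simp add: scaleR_matrix_vector_assoc [symmetric])

text \<open>
  The trace pairing agrees with the Euclidean inner product of matrices as soon as one argument is
  symmetric, so that the general theory of inner products applies to it.
\<close>

lemma mat_inner_eq_inner:
  assumes "symmetric Y"
  shows "mat_inner Y A = Y \<bullet> A" "mat_inner A Y = A \<bullet> Y"
proof -
  show "mat_inner A Y = A \<bullet> Y"
    using symmetric_nth [OF assms]
    by (simp add: mat_inner_def trace_def matrix_matrix_mult_def inner_vec_def)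
  then show "mat_inner Y A = Y \<bullet> A"
    by (simp add: mat_inner_def trace_mul_sym [of Y] inner_commute)
qed

lemma trace_eq_inner: "trace Y = Y \<bullet> mat 1"
  by (simp add: trace_def inner_vec_def mat_def if_distrib cong: if_cong)

lemma pos_def_imp_pos_semidef: "pos_def A \<Longrightarrow> pos_semidef A"
  unfolding pos_def_def pos_semidef_def by (metis inner_zero_left less_imp_le order_refl)

lemma psd_cauchy_schwarz:
  assumes "pos_semidef M"
  shows "(u \<bullet> (M *v w))\<^sup>2 \<le> (u \<bullet> (M *v u)) * (w \<bullet> (M *v w))"
proof -
  define a b c where "a = w \<bullet> (M *v w)" and "b = u \<bullet> (M *v w)" and "c = u \<bullet> (M *v u)"
  have nonneg: "0 \<le> z \<bullet> (M *v z)" for z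
    using assms by (auto simp: pos_semidef_def)
  have sw: "w \<bullet> (M *v u) = b"
    using assms inner_symmetric_swap by (auto simp: pos_semidef_def b_def)
  have q: "0 \<le> c * p\<^sup>2 + 2 * p * q * b + a * q\<^sup>2" for p q
    using nonneg [of "p *\<^sub>R u + q *\<^sub>R w"] sw
    by (simp add: matrix_vector_right_distrib matrix_vector_mult_scaleR inner_add_left inner_add_right
        power2_eq_square algebra_simps a_def b_def [symmetric] c_def)
  have "a \<ge> 0" "c \<ge> 0" using nonneg by (auto simp: a_def c_def)
  have "b\<^sup>2 \<le> c * a"
  proof (cases "a = 0")
    case True
    \<comment> \<open>The form is affine in \<open>q\<close> here, and this \<open>q\<close> gives it the value \<open>-1\<close> unless \<open>b = 0\<close>.\<close>
    have "b = 0"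
      using q [of 1 "- (c + 1) / (2 * b)"] True by (cases "b = 0") (auto simp: field_simps)
    then show ?thesis using True by simp
  next
    case False
    then have "a > 0" using \<open>a \<ge> 0\<close> by simp
    have "0 \<le> a * (c * a - b\<^sup>2)"
      using q [of a "- b"] by (simp add: power2_eq_square algebra_simps)
    then show ?thesis using \<open>a > 0\<close> by (simp add: zero_le_mult_iff)
  qed
  then show ?thesis by (simp add: a_def b_def c_def)
qed

lemma psd_kernel:
  assumes "pos_semidef M" "w \<bullet> (M *v w) = 0"
  shows "M *v w = 0"
  using psd_cauchy_schwarz [OF assms(1), of "M *v w" w] assms(2) by simp

text \<open>The rank one matrix \<open>v v\<^sup>T\<close>.\<close>

definition outer :: "real^'m \<Rightarrow> real^'m^'m" where
  "outer v = (\<chi> i j. v $ i * v $ j)"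

lemma outer_mult_vector: "outer v *v w = (v \<bullet> w) *\<^sub>R v"
  by (simp add: outer_def vec_eq_iff matrix_vector_mult_def inner_vec_def sum_distrib_left
      mult.commute mult.left_commute)

lemma inner_outer: "outer v \<bullet> A = v \<bullet> (A *v v)"
  by (simp add: outer_def matrix_vector_mult_def inner_vec_def sum_distrib_left
      mult.commute mult.left_commute)

lemma symmetric_outer: "symmetric (outer v)"
  by (simp add: outer_def symmetric_def transpose_def vec_eq_iff)

lemma norm_outer: "norm (outer v) = outer v \<bullet> mat 1"
  by (simp add: norm_eq_sqrt_inner inner_outer outer_mult_vector flip: power2_eq_square)

text \<open>
  One step of Cholesky elimination: a nonzero row of a positive semidefinite matrix has a positive
  diagonal entry, and subtracting the rank one matrix built from that row clears the row without
  destroying semidefiniteness. Only the number of nonzero rows has to decrease.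
\<close>

lemma psd_sum_outer:
  assumes "pos_semidef Y"
  shows "\<exists>vs. Y = sum_list (map outer vs)"
  using assms
proof (induction "card {i. Y $ i \<noteq> 0}" arbitrary: Y rule: less_induct)
  case less
  show ?case
  proof (cases "Y = 0")
    case True
    then have "Y = sum_list (map outer [])" by simp
    then show ?thesis by blast
  next
    case False
    then obtain i where i: "Y $ i \<noteq> 0" by (metis vec_eq_iff zero_index)
    have symY: "symmetric Y" using less.prems by (simp add: pos_semidef_def)
    define c where "c = Y $ i $ i"
    define v where "v = (1 / sqrt c) *\<^sub>R (Y *v axis i 1)"
    have col: "(Y *v axis i 1) $ j = Y $ i $ j" for j
      using symmetric_nth [OF symY] by (simp add: matrix_vector_mult_basis column_def)
    have c: "axis i 1 \<bullet> (Y *v axis i 1) = c"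
      by (simp add: inner_axis' col c_def)
    have "c \<noteq> 0"
      using psd_kernel [OF less.prems, of "axis i 1"] c i col by (auto simp: vec_eq_iff)
    moreover have "c \<ge> 0"
      using less.prems c by (metis pos_semidef_def)
    ultimately have "c > 0" by simp
    have vj: "v $ j = Y $ i $ j / sqrt c" for j
      by (simp add: v_def col)
    have psd: "pos_semidef (Y - outer v)"
      unfolding pos_semidef_def
    proof (intro conjI allI)
      show "symmetric (Y - outer v)" by (intro symmetric_diff symY symmetric_outer)
      fix w
      have "(v \<bullet> w)\<^sup>2 = (axis i 1 \<bullet> (Y *v w))\<^sup>2 / c"
        using \<open>c > 0\<close> inner_symmetric_swap [OF symY, of w "axis i 1"]
        by (simp add: v_def power_divide power_mult_distrib inner_commute)
      also have "\<dots> \<le> c * (w \<bullet> (Y *v w)) / c"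
        using psd_cauchy_schwarz [OF less.prems, of "axis i 1" w] \<open>c > 0\<close>
        by (intro divide_right_mono) (auto simp: c)
      finally show "0 \<le> w \<bullet> ((Y - outer v) *v w)"
        using \<open>c > 0\<close>
        by (simp add: matrix_vector_mult_diff_rdistrib outer_mult_vector inner_diff_right
            power2_eq_square inner_commute)
    qed
    have "{j. (Y - outer v) $ j \<noteq> 0} \<subseteq> {j. Y $ j \<noteq> 0} - {i}"
    proof -
      have "(Y - outer v) $ i = 0"
        using \<open>c > 0\<close> by (simp add: vec_eq_iff outer_def vj c_def [symmetric])
      moreover have "(Y - outer v) $ j = 0" if "Y $ j = 0" for j
        using that symmetric_nth [OF symY, of i j] by (simp add: vec_eq_iff outer_def vj)
      ultimately show ?thesis by auto
    qed
    then have "card {j. (Y - outer v) $ j \<noteq> 0} < card {j. Y $ j \<noteq> 0}"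
      using i by (intro psubset_card_mono) auto
    from less.hyps [OF this psd] obtain vs where "Y - outer v = sum_list (map outer vs)" ..
    then have "Y = sum_list (map outer (v # vs))" by (simp add: algebra_simps)
    then show ?thesis by blast
  qed
qed

lemma inner_sum_outer: "sum_list (map outer vs) \<bullet> A = sum_list (map (\<lambda>v. v \<bullet> (A *v v)) vs)"
  by (induction vs) (simp_all add: inner_add_left inner_outer)

lemma psd_inner_nonneg:
  assumes "pos_semidef Y" "pos_semidef Z"
  shows "0 \<le> Y \<bullet> Z"
proof -
  obtain vs where "Y = sum_list (map outer vs)" using psd_sum_outer assms(1) by blast
  then show ?thesis using assms(2)
    by (auto simp: inner_sum_outer pos_semidef_def intro!: sum_list_nonneg)
qed

lemma pos_semidef_mat_1: "pos_semidef (mat 1)"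
  by (simp add: pos_semidef_def symmetric_mat)

lemma psd_trace_nonneg: "pos_semidef Y \<Longrightarrow> 0 \<le> trace Y"
  by (simp add: trace_eq_inner psd_inner_nonneg pos_semidef_mat_1)

lemma psd_norm_le_trace:
  assumes "pos_semidef Y"
  shows "norm Y \<le> trace Y"
proof -
  have "norm (sum_list (map outer vs)) \<le> sum_list (map outer vs) \<bullet> mat 1" for vs :: "(real^'a) list"
    by (induction vs) (auto simp: inner_add_left norm_outer intro: norm_triangle_le)
  then show ?thesis using psd_sum_outer [OF assms] trace_eq_inner by metis
qed

lemma psd_inner_posdef_eq_0:
  assumes "pos_semidef Y" "pos_def Z" "Y \<bullet> Z = 0"
  shows "Y = 0"
proof -
  obtain vs where Y: "Y = sum_list (map outer vs)" using psd_sum_outer assms(1) by blast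
  have "0 \<le> v \<bullet> (Z *v v)" for v
    using assms(2) by (cases "v = 0") (auto simp: pos_def_def less_imp_le)
  then have "v \<bullet> (Z *v v) = 0" if "v \<in> set vs" for v
    using assms(3) that unfolding Y inner_sum_outer
    by (subst (asm) sum_list_nonneg_eq_0_iff) auto
  then have "v = 0" if "v \<in> set vs" for v
    using assms(2) that by (force simp: pos_def_def)
  then have "\<forall>v\<in>set vs. outer v = 0" by (auto simp: outer_def vec_eq_iff)
  then show ?thesis unfolding Y by (induction vs) auto
qed

lemma norm_psd_mult_le:
  assumes "pos_semidef B" "\<And>w. w \<bullet> (B *v w) \<le> b * (norm w)\<^sup>2" "0 \<le> b"
  shows "norm (B *v w) \<le> b * norm w"
proof -
  let ?u = "B *v w"
  have "(norm ?u ^ 2)\<^sup>2 \<le> (?u \<bullet> (B *v ?u)) * (w \<bullet> (B *v w))"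
    using psd_cauchy_schwarz [OF assms(1), of ?u w] by (simp add: power2_norm_eq_inner)
  also have "\<dots> \<le> (b * (norm ?u)\<^sup>2) * (b * (norm w)\<^sup>2)"
    using assms by (intro mult_mono) (auto simp: pos_semidef_def)
  also have "\<dots> = (norm ?u * (b * norm w))\<^sup>2"
    by (simp add: power2_eq_square mult_ac)
  finally have "norm ?u ^ 2 \<le> norm ?u * (b * norm w)"
    using assms(3) by (meson mult_nonneg_nonneg norm_ge_zero power2_le_imp_le)
  then show ?thesis
    using assms(3) by (cases "?u = 0") (auto simp: power2_eq_square)
qed

section \<open>The largest eigenvalue\<close>

text \<open>
  Eigenvectors to distinct eigenvalues are orthogonal, hence independent. Finiteness is what gives
  the maximum in the definition of \<open>max_eigenvalue\<close> its meaning.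
\<close>

lemma finite_eigenvalues:
  fixes A :: "real^'m^'m"
  assumes "symmetric A"
  shows "finite {c. \<exists>w. w \<noteq> 0 \<and> A *v w = c *\<^sub>R w}" (is "finite ?E")
proof -
  have "\<forall>c\<in>?E. \<exists>w. w \<noteq> 0 \<and> A *v w = c *\<^sub>R w" by blast
  from bchoice [OF this] obtain w where "\<forall>c\<in>?E. w c \<noteq> 0 \<and> A *v w c = c *\<^sub>R w c" ..
  then have w: "w c \<noteq> 0 \<and> A *v w c = c *\<^sub>R w c" if "c \<in> ?E" for c
    using that by (rule bspec)
  have orth: "w c \<bullet> w c' = 0" if "c \<in> ?E" "c' \<in> ?E" "c \<noteq> c'" for c c'
    using inner_symmetric_swap [OF assms, of "w c" "w c'"] w [OF that(1)] w [OF that(2)] that(3)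
    by (auto simp: inner_commute)
  have "inj_on w ?E"
  proof (rule inj_onI, rule ccontr)
    fix c c' assume "c \<in> ?E" "c' \<in> ?E" "w c = w c'" "c \<noteq> c'"
    then show False using orth [of c c'] w [of c] by simp
  qed
  have "independent (w ` ?E)"
  proof (rule pairwise_orthogonal_independent)
    show "pairwise orthogonal (w ` ?E)"
      unfolding pairwise_def orthogonal_def using orth by blast
    show "0 \<notin> w ` ?E"
    proof
      assume "0 \<in> w ` ?E"
      then obtain c where "0 = w c" "c \<in> ?E" by (rule imageE)
      with w [of c] show False by simp
    qed
  qed
  then have "finite (w ` ?E)" by (rule independent_imp_finite)
  then show ?thesis using \<open>inj_on w ?E\<close> finite_imageD by blast
qed

text \<open>
  Rayleigh's principle: at a maximizer of the quadratic form on the unit sphere, with value \<open>c\<close>, the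
  positive semidefinite matrix \<open>c I - A\<close> has a vanishing form, so the maximizer is an eigenvector.
\<close>

lemma max_eigenvalue_attained_and_bound:
  fixes A :: "real^'m^'m"
  assumes "symmetric A"
  shows "\<exists>w. norm w = 1 \<and> w \<bullet> (A *v w) = max_eigenvalue A"
    and "w \<bullet> (A *v w) \<le> max_eigenvalue A * (norm w)\<^sup>2"
proof -
  let ?E = "{c. \<exists>w. w \<noteq> 0 \<and> A *v w = c *\<^sub>R w}"
  have "compact (sphere (0::real^'m) 1)" by simp
  moreover have "axis undefined 1 \<in> sphere (0::real^'m) 1" by simp
  moreover have "continuous_on (sphere (0::real^'m) 1) (\<lambda>w. w \<bullet> (A *v w))"
    by (intro continuous_intros)
  ultimately obtain u where u: "norm u = 1" and
    max: "\<And>w. norm w = 1 \<Longrightarrow> w \<bullet> (A *v w) \<le> u \<bullet> (A *v u)"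
    using continuous_attains_sup [of "sphere (0::real^'m) 1" "\<lambda>w. w \<bullet> (A *v w)"] by auto
  define c where "c = u \<bullet> (A *v u)"
  have bound: "w \<bullet> (A *v w) \<le> c * (norm w)\<^sup>2" for w
  proof (cases "w = 0")
    case False
    have "sgn w \<bullet> (A *v sgn w) \<le> c" using max False by (simp add: c_def norm_sgn)
    then show ?thesis using False
      by (simp add: sgn_div_norm matrix_vector_mult_scaleR field_simps power2_eq_square)
  qed simp
  have form: "w \<bullet> ((c *\<^sub>R mat 1 - A) *v w) = c * (norm w)\<^sup>2 - w \<bullet> (A *v w)" for w
    by (simp add: matrix_vector_mult_diff_rdistrib scaleR_mat_1_vector inner_diff_right
        power2_norm_eq_inner)
  have "pos_semidef (c *\<^sub>R mat 1 - A)"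
    using bound assms
    by (auto simp: pos_semidef_def form intro!: symmetric_diff symmetric_scaleR symmetric_mat)
  moreover have "u \<bullet> ((c *\<^sub>R mat 1 - A) *v u) = 0"
    by (simp only: form) (simp add: u c_def)
  ultimately have "A *v u = c *\<^sub>R u"
    using psd_kernel by (fastforce simp: matrix_vector_mult_diff_rdistrib scaleR_mat_1_vector)
  moreover have "u \<noteq> 0" using u by auto
  ultimately have "c \<in> ?E" by blast
  moreover have "e \<le> c" if "e \<in> ?E" for e
  proof -
    from that have "\<exists>w. w \<noteq> 0 \<and> A *v w = e *\<^sub>R w" by (rule CollectD)
    then obtain w where "w \<noteq> 0" "A *v w = e *\<^sub>R w" by (elim exE conjE)
    then have "e * (norm w)\<^sup>2 \<le> c * (norm w)\<^sup>2"
      using bound [of w] by (simp only: inner_scaleR_right power2_norm_eq_inner)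
    then show ?thesis using \<open>w \<noteq> 0\<close> by simp
  qed
  ultimately have "max_eigenvalue A = c"
    unfolding max_eigenvalue_def using finite_eigenvalues [OF assms] by (intro Max_eqI) auto
  then show "\<exists>w. norm w = 1 \<and> w \<bullet> (A *v w) = max_eigenvalue A"
    and "w \<bullet> (A *v w) \<le> max_eigenvalue A * (norm w)\<^sup>2"
    using u bound c_def by auto
qed

lemma loewner_le_scaled_identity_iff:
  assumes "symmetric A"
  shows "A \<preceq>\<^sub>L c *\<^sub>R mat 1 \<longleftrightarrow> max_eigenvalue A \<le> c"
proof -
  have "w \<bullet> ((c *\<^sub>R mat 1 - A) *v w) = c * (norm w)\<^sup>2 - w \<bullet> (A *v w)" for w
    by (simp add: matrix_vector_mult_diff_rdistrib scaleR_mat_1_vector inner_diff_right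
        power2_norm_eq_inner)
  then have "A \<preceq>\<^sub>L c *\<^sub>R mat 1 \<longleftrightarrow> (\<forall>w. w \<bullet> (A *v w) \<le> c * (norm w)\<^sup>2)"
    using assms
    by (auto simp: loewner_le_def pos_semidef_def intro!: symmetric_diff symmetric_scaleR symmetric_mat)
  also have "\<dots> \<longleftrightarrow> max_eigenvalue A \<le> c"
  proof
    assume le: "\<forall>w. w \<bullet> (A *v w) \<le> c * (norm w)\<^sup>2"
    obtain w where "norm w = 1" "w \<bullet> (A *v w) = max_eigenvalue A"
      using max_eigenvalue_attained_and_bound(1) [OF assms] by blast
    with le [rule_format, of w] show "max_eigenvalue A \<le> c" by simp
  next
    assume "max_eigenvalue A \<le> c"
    then show "\<forall>w. w \<bullet> (A *v w) \<le> c * (norm w)\<^sup>2"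
      using max_eigenvalue_attained_and_bound(2) [OF assms]
      by (meson mult_right_mono order_trans zero_le_power2)
  qed
  finally show ?thesis .
qed

lemma max_eigenvalue_convex:
  assumes "symmetric A" "symmetric B" "0 \<le> u" "u \<le> 1"
  shows "max_eigenvalue ((1 - u) *\<^sub>R A + u *\<^sub>R B) \<le> (1 - u) * max_eigenvalue A + u * max_eigenvalue B"
proof -
  have "symmetric ((1 - u) *\<^sub>R A + u *\<^sub>R B)"
    by (intro symmetric_add symmetric_scaleR assms)
  then obtain w where w: "norm w = 1"
    "max_eigenvalue ((1 - u) *\<^sub>R A + u *\<^sub>R B) = w \<bullet> (((1 - u) *\<^sub>R A + u *\<^sub>R B) *v w)"
    using max_eigenvalue_attained_and_bound(1) by metis
  note w(2)
  also have "w \<bullet> (((1 - u) *\<^sub>R A + u *\<^sub>R B) *v w) = (1 - u) * (w \<bullet> (A *v w)) + u * (w \<bullet> (B *v w))"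
    by (simp add: matrix_vector_mult_add_rdistrib inner_add_right scaleR_matrix_vector_assoc [symmetric])
  also have "\<dots> \<le> (1 - u) * max_eigenvalue A + u * max_eigenvalue B"
    using max_eigenvalue_attained_and_bound(2) [OF assms(1), of w]
      max_eigenvalue_attained_and_bound(2) [OF assms(2), of w] w(1) assms(3,4)
    by (intro add_mono mult_left_mono) auto
  finally show ?thesis .
qed

lemma norm_matrix_vector_le:
  fixes A :: "real^'n^'m"
  shows "norm (A *v w) \<le> norm A * norm w"
proof -
  have "norm (A *v w) \<le> L2_set (\<lambda>i. norm (A $ i) * norm w) UNIV"
    unfolding norm_vec_def [of "A *v w"]
    by (intro L2_set_mono) (auto simp: matrix_vector_mul_component Cauchy_Schwarz_ineq2)
  also have "\<dots> = norm A * norm w"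
    by (simp add: norm_vec_def [of A] L2_set_left_distrib)
  finally show ?thesis .
qed

lemma max_eigenvalue_le_add_norm:
  assumes "symmetric A" "symmetric B"
  shows "max_eigenvalue B \<le> max_eigenvalue A + norm (B - A)"
proof -
  obtain w where w: "norm w = 1" "w \<bullet> (B *v w) = max_eigenvalue B"
    using max_eigenvalue_attained_and_bound(1) assms(2) by blast
  have "w \<bullet> (B *v w) = w \<bullet> (A *v w) + w \<bullet> ((B - A) *v w)"
    by (simp add: matrix_vector_mult_diff_rdistrib inner_diff_right)
  moreover have "w \<bullet> (A *v w) \<le> max_eigenvalue A"
    using max_eigenvalue_attained_and_bound(2) [OF assms(1), of w] w by simp
  moreover have "w \<bullet> ((B - A) *v w) \<le> norm (B - A)"
    using norm_cauchy_schwarz [of w "(B - A) *v w"] norm_matrix_vector_le [of "B - A" w] w by simp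
  ultimately show ?thesis using w by linarith
qed

lemma tendsto_max_eigenvalue:
  assumes "(A \<longlongrightarrow> L) F" "\<And>i. symmetric (A i)" "symmetric L"
  shows "((\<lambda>i. max_eigenvalue (A i)) \<longlongrightarrow> max_eigenvalue L) F"
proof (rule tendstoI)
  fix e :: real assume "0 < e"
  with assms(1) have "\<forall>\<^sub>F i in F. dist (A i) L < e" by (rule tendstoD)
  then show "\<forall>\<^sub>F i in F. dist (max_eigenvalue (A i)) (max_eigenvalue L) < e"
  proof eventually_elim
    case (elim i)
    then show ?case
      using max_eigenvalue_le_add_norm [of "A i" L] max_eigenvalue_le_add_norm [of L "A i"] assms(2,3)
      by (auto simp: dist_norm norm_minus_commute)
  qed
qed

section \<open>Derivatives\<close>

lemma twice_cont_diff_imp_C1: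
  assumes "twice_cont_diff F"
  shows "\<exists>F'. (\<forall>x. (F has_derivative blinfun_apply (F' x)) (at x)) \<and> (\<forall>x. isCont F' x)"
  using assms unfolding twice_cont_diff_def by (metis has_derivative_continuous)

lemma C1_uniform_linearization:
  fixes F :: "'a::real_normed_vector \<Rightarrow> 'b::real_normed_vector"
  assumes der: "\<And>x. (F has_derivative blinfun_apply (F' x)) (at x)" and "isCont F' a" "0 < e"
  shows "\<exists>r>0. \<forall>x\<in>ball a r. \<forall>y\<in>ball a r. norm (F y - F x - F' x (y - x)) \<le> e * norm (y - x)"
proof -
  obtain r where r: "0 < r" "\<And>x. dist x a < r \<Longrightarrow> dist (F' x) (F' a) < e / 2"
    using assms(2,3) unfolding continuous_at_eps_delta by (metis half_gt_zero)
  have "norm (F y - F x - F' x (y - x)) \<le> e * norm (y - x)" if xy: "x \<in> ball a r" "y \<in> ball a r" for x y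
  proof -
    have "norm (F y - F x - F' x (y - x)) \<le> norm (y - x) * e"
    proof (rule differentiable_bound_linearization [where S = "ball a r"])
      show "x + u *\<^sub>R (y - x) \<in> ball a r" if "u \<in> {0..1}" for u
        using xy that convexD_alt [OF convex_ball, of x a r y u] by (simp add: algebra_simps)
      show "(F has_derivative blinfun_apply (F' z)) (at z within ball a r)" for z
        using der by (rule has_derivative_at_withinI)
      show "onorm (blinfun_apply (F' z) - blinfun_apply (F' x)) \<le> e" if "z \<in> ball a r" for z
      proof -
        have "norm (F' z - F' x) \<le> e"
          using r(2) [of z] r(2) [of x] that xy dist_triangle_half_l [of "F' z" "F' a" e "F' x"]
          by (simp add: dist_commute dist_norm norm_minus_commute)
        then show ?thesis
          by (simp add: norm_blinfun.rep_eq minus_blinfun.rep_eq fun_diff_def)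
      qed
    qed (use xy in auto)
    then show ?thesis by (simp add: mult.commute)
  qed
  then show ?thesis using r(1) by blast
qed

lemma partial_deriv_eq:
  assumes "(F has_derivative F') (at x)"
  shows "partial_deriv F i x = F' (axis i 1)"
proof -
  have "((\<lambda>\<tau>. x + \<tau> *\<^sub>R axis i 1) has_derivative (\<lambda>\<tau>. \<tau> *\<^sub>R axis i 1)) (at (0::real))"
    by (auto intro!: derivative_eq_intros)
  moreover have "(F has_derivative F') (at (x + 0 *\<^sub>R axis i 1))" using assms by simp
  ultimately have "((\<lambda>\<tau>. F (x + \<tau> *\<^sub>R axis i 1)) has_derivative (\<lambda>\<tau>. F' (\<tau> *\<^sub>R axis i 1))) (at 0)"
    by (rule has_derivative_compose)
  moreover have "F' (\<tau> *\<^sub>R axis i 1) = \<tau> *\<^sub>R F' (axis i 1)" for \<tau>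
    by (rule linear_cmul [OF has_derivative_linear [OF assms]])
  ultimately show ?thesis
    unfolding partial_deriv_def by (simp add: has_vector_derivative_def vector_derivative_at)
qed

lemma derivative_eq_sum_axis:
  assumes "(F has_derivative F') (at (x :: real^'n))"
  shows "F' d = (\<Sum>i\<in>UNIV. (d $ i) *\<^sub>R F' (axis i 1))"
proof -
  interpret linear F' using assms by (rule has_derivative_linear)
  have "d = (\<Sum>i\<in>UNIV. (d $ i) *\<^sub>R axis i 1)"
    by (simp add: basis_expansion flip: scalar_mult_eq_scaleR)
  then have "F' d = F' (\<Sum>i\<in>UNIV. (d $ i) *\<^sub>R axis i 1)" by simp
  then show ?thesis by (simp add: sum scale)
qed

lemma DG_eq: "(G has_derivative G') (at x) \<Longrightarrow> DG G x d = G' d"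
  by (subst derivative_eq_sum_axis [of G G']) (simp_all add: DG_def partial_deriv_eq)

lemma grad_inner_eq: "(f has_derivative f') (at x) \<Longrightarrow> grad f x \<bullet> d = f' d"
  by (subst derivative_eq_sum_axis [of f f'])
     (simp_all add: grad_def inner_vec_def partial_deriv_eq mult.commute)

lemma Dh_mult_eq: "(h has_derivative h') (at x) \<Longrightarrow> Dh h x *v d = h' d"
  by (metis frechet_derivative_at differentiableI jacobian_works has_derivative_unique)

lemma inner_DG_adj: "w \<bullet> DG_adj G x Y = mat_inner (DG G x w) Y"
proof -
  have "linear (\<lambda>A. mat_inner A Y)"
    by (intro linearI)
       (simp_all add: mat_inner_def trace_def matrix_matrix_mult_def sum_distrib_left sum.distrib
          distrib_right mult.assoc)
  then interpret linear "\<lambda>A. mat_inner A Y" .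
  show ?thesis by (simp add: DG_def DG_adj_def inner_vec_def sum scale)
qed

lemma symmetric_derivative:
  assumes "\<And>y. symmetric (G y)" "(G has_derivative G') (at x)"
  shows "symmetric (G' d)"
proof -
  have "linear (transpose :: real^'m^'m \<Rightarrow> _)"
    by (intro linearI) (auto simp: transpose_def vec_eq_iff)
  then have "bounded_linear (transpose :: real^'m^'m \<Rightarrow> _)" by (simp add: linear_conv_bounded_linear)
  from bounded_linear.has_derivative [OF this assms(2)]
  have "(G has_derivative (\<lambda>d. transpose (G' d))) (at x)"
    using assms(1) by (simp add: symmetric_def)
  from has_derivative_unique [OF this assms(2)] show ?thesis
    unfolding symmetric_def by metis
qed

section \<open>The constraint violation and its linearization\<close>

lemma l1_norm_nonneg: "0 \<le> l1_norm a"
  by (simp add: l1_norm_def sum_nonneg)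

lemma l1_norm_triangle: "l1_norm (a + b) \<le> l1_norm a + l1_norm b"
  by (simp add: l1_norm_def flip: sum.distrib) (intro sum_mono abs_triangle_ineq)

lemma l1_norm_scaleR: "l1_norm (c *\<^sub>R a) = \<bar>c\<bar> * l1_norm a"
  by (simp add: l1_norm_def abs_mult sum_distrib_left)

lemma l1_norm_le_norm: "l1_norm (a :: real^'l) \<le> real CARD('l) * norm a"
  unfolding l1_norm_def using sum_bounded_above [of UNIV "\<lambda>i. \<bar>a $ i\<bar>" "norm a"]
  by (simp add: component_le_norm_cart)

lemma lin_violation_0: "lin_violation h G x 0 = violation h G x"
  by (simp add: lin_violation_def violation_def DG_def)

text \<open>
  The violation is a convex Lipschitz function of the pair of constraint values, so along a segment
  it exceeds the interpolation of its linearization by at most a multiple of the linearization errors.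
\<close>

lemma violation_step_le:
  fixes h :: "real^'n \<Rightarrow> real^'l"
  assumes sym: "\<And>y. symmetric (G y)" "symmetric (DG G x d)" and u: "0 \<le> u" "u \<le> 1"
  shows "violation h G (x + u *\<^sub>R d) \<le> violation h G x - u * violation_decrease h G x d
     + real CARD('l) * norm (h (x + u *\<^sub>R d) - h x - u *\<^sub>R (Dh h x *v d))
     + norm (G (x + u *\<^sub>R d) - G x - u *\<^sub>R DG G x d)"
proof -
  define E where "E = h (x + u *\<^sub>R d) - h x - u *\<^sub>R (Dh h x *v d)"
  define A where "A = (1 - u) *\<^sub>R G x + u *\<^sub>R (G x + DG G x d)"
  have "h (x + u *\<^sub>R d) = ((1 - u) *\<^sub>R h x + u *\<^sub>R (h x + Dh h x *v d)) + E"
    by (simp add: E_def algebra_simps)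
  then have "l1_norm (h (x + u *\<^sub>R d))
      \<le> l1_norm ((1 - u) *\<^sub>R h x + u *\<^sub>R (h x + Dh h x *v d)) + l1_norm E"
    by (metis l1_norm_triangle)
  also have "\<dots> \<le> (1 - u) * l1_norm (h x) + u * l1_norm (h x + Dh h x *v d) + real CARD('l) * norm E"
    using l1_norm_triangle [of "(1 - u) *\<^sub>R h x" "u *\<^sub>R (h x + Dh h x *v d)"] u l1_norm_le_norm [of E]
    by (simp add: l1_norm_scaleR)
  finally have 1: "l1_norm (h (x + u *\<^sub>R d))
      \<le> (1 - u) * l1_norm (h x) + u * l1_norm (h x + Dh h x *v d) + real CARD('l) * norm E" .
  have symA: "symmetric A" unfolding A_def by (intro symmetric_add symmetric_scaleR sym)
  have "G (x + u *\<^sub>R d) - A = G (x + u *\<^sub>R d) - G x - u *\<^sub>R DG G x d"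
    by (simp add: A_def algebra_simps)
  then have "max_eigenvalue (G (x + u *\<^sub>R d))
      \<le> max_eigenvalue A + norm (G (x + u *\<^sub>R d) - G x - u *\<^sub>R DG G x d)"
    using max_eigenvalue_le_add_norm [OF symA sym(1)] by metis
  moreover have "max_eigenvalue A \<le> (1 - u) * max_eigenvalue (G x) + u * max_eigenvalue (G x + DG G x d)"
    unfolding A_def by (intro max_eigenvalue_convex symmetric_add sym u)
  moreover have "\<dots> \<le> (1 - u) * max 0 (max_eigenvalue (G x)) + u * max 0 (max_eigenvalue (G x + DG G x d))"
    using u by (intro add_mono mult_left_mono) auto
  moreover have "0 \<le> (1 - u) * max 0 (max_eigenvalue (G x)) + u * max 0 (max_eigenvalue (G x + DG G x d))"
    using u by simp
  ultimately have 2: "max 0 (max_eigenvalue (G (x + u *\<^sub>R d)))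
      \<le> (1 - u) * max 0 (max_eigenvalue (G x)) + u * max 0 (max_eigenvalue (G x + DG G x d))
         + norm (G (x + u *\<^sub>R d) - G x - u *\<^sub>R DG G x d)"
    by (smt (verit) norm_ge_zero)
  show ?thesis
    using 1 2 unfolding violation_decrease_def lin_violation_0 unfolding violation_def lin_violation_def E_def
    by (simp add: algebra_simps)
qed

lemma isCont_violation:
  assumes "isCont h a" "isCont G a" "\<And>y. symmetric (G y)"
  shows "isCont (violation h G) a"
  using assms unfolding violation_def l1_norm_def isCont_def
  by (intro tendsto_intros tendsto_max_eigenvalue) auto

section \<open>The two subproblems\<close>

lemma fea_solution_objective_le:
  assumes "\<And>y. symmetric (G y)" "fea_solution h G x B (d, r, s, t)"
  shows "1 \<bullet> (r + s) + t + 1/2 * (d \<bullet> (B *v d)) \<le> violation h G x"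
proof -
  have "fea_feasible h G x (0, pos_part (h x), - neg_part (h x), max 0 (max_eigenvalue (G x)))"
    using loewner_le_scaled_identity_iff [OF assms(1)]
    by (auto simp: fea_feasible_def DG_def pos_part_def neg_part_def vec_eq_iff less_eq_vec_def)
  with assms(2) have "fea_objective B (d, r, s, t)
      \<le> fea_objective B (0, pos_part (h x), - neg_part (h x), max 0 (max_eigenvalue (G x)))"
    unfolding fea_solution_def by blast
  also have "1 \<bullet> (pos_part (h x) - neg_part (h x)) = l1_norm (h x)"
    by (auto simp: inner_vec_def l1_norm_def pos_part_def neg_part_def intro!: sum.cong)
  then have "fea_objective B (0, pos_part (h x), - neg_part (h x), max 0 (max_eigenvalue (G x)))
      = violation h G x"
    by (simp add: fea_objective_def violation_def)
  finally show ?thesis by (simp add: fea_objective_def)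
qed

lemma lin_violation_le_shift:
  assumes "symmetric (G x)" "symmetric (DG G x d)" "opt_feasible h G x r s t d"
    and "0 \<le> r" "0 \<le> s" "0 \<le> t"
  shows "lin_violation h G x d \<le> 1 \<bullet> (r + s) + t"
proof -
  have "max_eigenvalue (G x + DG G x d) \<le> t"
    using assms loewner_le_scaled_identity_iff [OF symmetric_add [OF assms(1,2)]]
    by (simp add: opt_feasible_def)
  moreover have "l1_norm (r - s) \<le> 1 \<bullet> (r + s)"
    using assms(4,5) by (auto simp: l1_norm_def inner_vec_def less_eq_vec_def abs_le_iff add_increasing
        add_increasing2 intro!: sum_mono)
  ultimately show ?thesis
    using assms by (simp add: lin_violation_def opt_feasible_def)
qed

text \<open>
  Every step that is feasible for the second subproblem reaches the shift found by the first one, so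
  the optimal value of the first subproblem controls the predicted decrease of the violation.
\<close>

lemma violation_decrease_ge:
  assumes "\<And>y. symmetric (G y)" "symmetric (DG G x d)"
    and "fea_solution h G x B (dfea, r, s, t)" "opt_feasible h G x r s t d"
  shows "1/2 * (dfea \<bullet> (B *v dfea)) \<le> violation_decrease h G x d"
  using fea_solution_objective_le [OF assms(1,3)] lin_violation_le_shift [OF assms(1,2,4)] assms(3)
  by (simp add: violation_decrease_def lin_violation_0 fea_solution_def fea_feasible_def)

text \<open>
  The Lagrangian is quadratic along every line, so its derivative in a direction can be read off as
  the linear coefficient.
\<close>

lemma has_derivative_0_along_quadratic:
  fixes L :: "'a::real_normed_vector \<Rightarrow> real"
  assumes "(L has_derivative (\<lambda>_. 0)) (at z)"
    and "\<And>\<tau>. L (z + \<tau> *\<^sub>R w) = L z + \<tau> * a + \<tau>\<^sup>2 * b"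
  shows "a = 0"
proof -
  have "((\<lambda>\<tau>. z + \<tau> *\<^sub>R w) has_derivative (\<lambda>\<tau>. \<tau> *\<^sub>R w)) (at (0::real))"
    by (auto intro!: derivative_eq_intros)
  moreover have "(L has_derivative (\<lambda>_. 0)) (at (z + 0 *\<^sub>R w))" using assms by simp
  ultimately have "((\<lambda>\<tau>. L (z + \<tau> *\<^sub>R w)) has_derivative (\<lambda>_. 0)) (at 0)"
    by (rule has_derivative_compose)
  then have "((\<lambda>\<tau>. L z + \<tau> * a + \<tau>\<^sup>2 * b) has_real_derivative 0) (at 0)"
    by (simp add: assms(2) has_field_derivative_def lambda_zero)
  moreover have "((\<lambda>\<tau>. L z + \<tau> * a + \<tau>\<^sup>2 * b) has_real_derivative a) (at 0)"
    by (auto intro!: derivative_eq_intros)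
  ultimately show ?thesis using DERIV_unique by blast
qed

lemma nonneg_inner_eq_0_imp_mult_eq_0:
  fixes a b :: "real^'l"
  assumes "0 \<le> a" "0 \<le> b" "a \<bullet> b = 0"
  shows "a * b = 0"
proof -
  have "0 \<le> a $ i * b $ i" for i using assms by (simp add: less_eq_vec_def)
  then have "\<forall>i. a $ i * b $ i = 0"
    using assms(3) sum_nonneg_eq_0_iff [of UNIV "\<lambda>i. a $ i * b $ i"] by (simp add: inner_vec_def)
  then show ?thesis by (simp add: vec_eq_iff)
qed

text \<open>
  The sign conditions on the multipliers of \<open>r\<close>, \<open>s\<close>, \<open>t\<close> bound the multipliers of the first
  subproblem; they are the reason why a limit of these multipliers exists.
\<close>

lemma fea_multipliers_kkt:
  assumes "fea_multipliers h G x B (d, r, s, t) \<mu> Y" "fea_feasible h G x (d, r, s, t)" "symmetric B"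
    and "(h has_derivative h') (at x)" "(G has_derivative G') (at x)"
  shows "w \<bullet> (B *v d) + \<mu> \<bullet> h' w + Y \<bullet> G' w = 0"
    and "(1 - \<mu>) * r = 0" "(1 + \<mu>) * s = 0" "(1 - trace Y) * t = 0"
    and "- 1 \<le> \<mu>" "\<mu> \<le> 1" "trace Y \<le> 1"
proof -
  have psd: "pos_semidef Y" using assms(1) by (simp add: fea_multipliers_def)
  obtain \<nu>r \<nu>s \<nu>t where \<nu>: "0 \<le> \<nu>r" "0 \<le> \<nu>s" "0 \<le> \<nu>t" "\<nu>r \<bullet> r = 0" "\<nu>s \<bullet> s = 0" "\<nu>t * t = 0"
    and der: "(fea_lagrangian h G x B \<mu> Y \<nu>r \<nu>s \<nu>t has_derivative (\<lambda>_. 0)) (at (d, r, s, t))"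
    using assms(1) by (auto simp: fea_multipliers_def)
  have lin: "h' (d + \<tau> *\<^sub>R w) = h' d + \<tau> *\<^sub>R h' w" "G' (d + \<tau> *\<^sub>R w) = G' d + \<tau> *\<^sub>R G' w" for \<tau> w
    using assms(4,5)
    by (simp_all add: linear_add linear_cmul has_derivative_linear)
  have mi: "mat_inner Y A = Y \<bullet> A" for A
    using psd by (simp add: mat_inner_eq_inner pos_semidef_def)
  let ?L = "fea_lagrangian h G x B \<mu> Y \<nu>r \<nu>s \<nu>t"
  note L_def = fea_lagrangian_def fea_objective_def mi DG_eq [OF assms(5)] Dh_mult_eq [OF assms(4)] lin
  note simps = inner_add_left inner_add_right inner_diff_right inner_scaleR_left inner_scaleR_right
    matrix_vector_right_distrib matrix_vector_mult_scaleR power2_eq_square algebra_simps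
  have "?L ((d, r, s, t) + \<tau> *\<^sub>R (w, 0, 0, 0))
      = ?L (d, r, s, t) + \<tau> * (w \<bullet> (B *v d) + \<mu> \<bullet> h' w + Y \<bullet> G' w) + \<tau>\<^sup>2 * (1/2 * (w \<bullet> (B *v w)))" for \<tau> w
    using inner_symmetric_swap [OF assms(3), of d w] by (simp add: L_def simps)
  from has_derivative_0_along_quadratic [OF der this]
  show "w \<bullet> (B *v d) + \<mu> \<bullet> h' w + Y \<bullet> G' w = 0" .
  have "?L ((d, r, s, t) + \<tau> *\<^sub>R (0, w, 0, 0)) = ?L (d, r, s, t) + \<tau> * ((1 - \<mu> - \<nu>r) \<bullet> w) + \<tau>\<^sup>2 * 0" for \<tau> w
    by (simp add: L_def simps inner_diff_left)
  from has_derivative_0_along_quadratic [OF der this] have "1 - \<mu> - \<nu>r = 0"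
    by (metis inner_eq_zero_iff)
  then have r: "1 - \<mu> = \<nu>r" by (simp add: algebra_simps)
  have "?L ((d, r, s, t) + \<tau> *\<^sub>R (0, 0, w, 0)) = ?L (d, r, s, t) + \<tau> * ((1 + \<mu> - \<nu>s) \<bullet> w) + \<tau>\<^sup>2 * 0" for \<tau> w
    by (simp add: L_def simps inner_diff_left)
  from has_derivative_0_along_quadratic [OF der this] have "1 + \<mu> - \<nu>s = 0"
    by (metis inner_eq_zero_iff)
  then have s: "1 + \<mu> = \<nu>s" by (simp add: algebra_simps)
  have "?L ((d, r, s, t) + \<tau> *\<^sub>R (0, 0, 0, 1)) = ?L (d, r, s, t) + \<tau> * (1 - trace Y - \<nu>t) + \<tau>\<^sup>2 * 0" for \<tau>
    by (simp add: L_def simps trace_eq_inner)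
  from has_derivative_0_along_quadratic [OF der this] have t: "1 - trace Y = \<nu>t" by simp
  have nn: "0 \<le> r" "0 \<le> s" using assms(2) by (simp_all add: fea_feasible_def)
  show "(1 - \<mu>) * r = 0" "(1 + \<mu>) * s = 0" "(1 - trace Y) * t = 0"
    unfolding r s t using \<nu> nn nonneg_inner_eq_0_imp_mult_eq_0 by auto
  show "\<mu> \<le> 1" "- 1 \<le> \<mu>" "trace Y \<le> 1"
    using \<nu>(1-3) unfolding r [symmetric] s [symmetric] t [symmetric]
    by (simp_all add: less_eq_vec_def) (metis add.commute neg_le_iff_le diff_0 diff_le_eq minus_minus)
qed

text \<open>
  The feasibility step competes in the second subproblem, whose step is therefore bounded by
  coercivity.
\<close>

lemma opt_solution_norm_le:
  assumes "opt_solution f h G x \<rho> B r s t d" "opt_feasible h G x r s t d'"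
    and "0 < b1" "b1 * (norm d)\<^sup>2 \<le> d \<bullet> (B *v d)" "d' \<bullet> (B *v d') \<le> b2 * (norm d')\<^sup>2"
    and "norm (\<rho> *\<^sub>R grad f x) \<le> M" "norm d' \<le> D" "0 \<le> b2"
  shows "norm d \<le> max 1 (2 * (M + M * D + b2 * D\<^sup>2 / 2) / b1)"
proof (cases "norm d \<le> 1")
  case False
  have inner: "\<rho> * (grad f x \<bullet> w) \<le> M * norm w \<and> - (M * norm w) \<le> \<rho> * (grad f x \<bullet> w)" for w
    using Cauchy_Schwarz_ineq2 [of "\<rho> *\<^sub>R grad f x" w] mult_right_mono [OF assms(6), of "norm w"]
    by (auto simp: abs_le_iff)
  have "0 \<le> M" using assms(6) norm_ge_zero order_trans by blast
  have "0 \<le> D" using assms(7) norm_ge_zero order_trans by blast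
  have "(norm d')\<^sup>2 \<le> D\<^sup>2" using assms(7) by (simp add: power_mono)
  then have dd: "d' \<bullet> (B *v d') \<le> b2 * D\<^sup>2"
    using assms(5,8) mult_left_mono by fastforce
  have "\<rho> * (grad f x \<bullet> d) + 1/2 * (d \<bullet> (B *v d)) \<le> \<rho> * (grad f x \<bullet> d') + 1/2 * (d' \<bullet> (B *v d'))"
    using assms(1,2) by (auto simp: opt_solution_def opt_objective_def)
  then have "b1 * (norm d)\<^sup>2 \<le> 2 * (M * norm d + M * norm d' + b2 * D\<^sup>2 / 2)"
    using inner [of d] inner [of d'] assms(4) dd by (simp add: algebra_simps)
  also have "\<dots> \<le> 2 * (M * norm d + M * D + b2 * D\<^sup>2 / 2)"
    using mult_left_mono [OF assms(7) \<open>0 \<le> M\<close>] by simp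
  also have "\<dots> \<le> 2 * ((M + M * D + b2 * D\<^sup>2 / 2) * norm d)"
  proof -
    have "(M * D + b2 * D\<^sup>2 / 2) * 1 \<le> (M * D + b2 * D\<^sup>2 / 2) * norm d"
      using False \<open>0 \<le> M\<close> \<open>0 \<le> D\<close> assms(8) by (intro mult_left_mono) auto
    then show ?thesis by (simp add: algebra_simps)
  qed
  finally have "(b1 * norm d) * norm d \<le> (2 * (M + M * D + b2 * D\<^sup>2 / 2)) * norm d"
    by (simp add: power2_eq_square mult_ac)
  then have "b1 * norm d \<le> 2 * (M + M * D + b2 * D\<^sup>2 / 2)"
    by (rule mult_right_le_imp_le) (use False in linarith)
  then show ?thesis using assms(3) by (simp add: field_simps le_max_iff_disj)
qed simp

section \<open>Penalty update and line search\<close>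

lemma multiplier_update_nonneg:
  assumes "0 \<le> \<rho>" "0 \<le> \<sigma>" "0 \<le> \<sigma>'" "\<epsilon> < 1" "0 < \<delta>"
  shows "0 \<le> multiplier_update \<epsilon> \<delta> \<rho> \<sigma> \<sigma>'"
  using assms by (auto simp: multiplier_update_def)

text \<open>
  If the predicted decrease of the penalty function is too small for \<open>\<rho>'\<close>, then the slope
  \<open>grad f x \<bullet> d\<close> is positive, so the quotient in the update is nonnegative and caps the penalty
  parameter at a value for which the predicted decrease suffices.
\<close>

lemma decrease_update_properties:
  fixes f :: "real^'n \<Rightarrow> real" and h :: "real^'n \<Rightarrow> real^'l" and G :: "real^'n \<Rightarrow> real^'m^'m"
  assumes "0 \<le> \<rho>'" "0 < \<epsilon>" "\<epsilon> < 1" "0 < \<delta>" "0 \<le> violation_decrease h G x d" "0 \<le> d \<bullet> (B *v d)"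
  defines "\<rho> \<equiv> decrease_update f h G \<epsilon> \<delta> x B d \<rho>'"
  shows "0 \<le> \<rho>" "\<epsilon> * violation_decrease h G x d \<le> penalty_decrease f h G \<rho> x d"
proof -
  define v where "v = violation_decrease h G x d"
  define g where "g = grad f x \<bullet> d"
  have "0 \<le> \<rho> \<and> \<epsilon> * v \<le> - \<rho> * g + v"
  proof (cases "- \<rho>' * g + v < \<epsilon> * v")
    case False
    then have "\<rho> = \<rho>'" by (simp add: \<rho>_def decrease_update_def penalty_decrease_def v_def g_def)
    then show ?thesis using False assms(1) by simp
  next
    case True
    define q where "q = g + 1/2 * (d \<bullet> (B *v d))"
    have \<rho>: "\<rho> = min (\<delta> * \<rho>') ((1 - \<epsilon>) * v / q)"
      using True by (simp add: \<rho>_def decrease_update_def penalty_decrease_def v_def g_def q_def)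
    have v: "0 \<le> (1 - \<epsilon>) * v" using assms by (simp add: v_def)
    moreover have "(1 - \<epsilon>) * v < \<rho>' * g" using True by (simp add: algebra_simps)
    ultimately have "0 < \<rho>' * g" by linarith
    then have "0 < g" using assms(1) by (simp add: zero_less_mult_iff)
    then have "g \<le> q" "0 < q" using assms(6) by (auto simp: q_def)
    have "0 \<le> \<rho>" unfolding \<rho> using v \<open>0 < q\<close> assms(1,4) by simp
    moreover have "\<rho> * g \<le> (1 - \<epsilon>) * v"
    proof -
      have "\<rho> * g \<le> \<rho> * q" using \<open>0 \<le> \<rho>\<close> \<open>g \<le> q\<close> by (rule mult_left_mono [rotated])
      also have "\<dots> \<le> (1 - \<epsilon>) * v / q * q" unfolding \<rho> using \<open>0 < q\<close> by (intro mult_right_mono) auto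
      finally show ?thesis using \<open>0 < q\<close> by simp
    qed
    ultimately show ?thesis by (simp add: algebra_simps)
  qed
  then show "0 \<le> \<rho>" "\<epsilon> * violation_decrease h G x d \<le> penalty_decrease f h G \<rho> x d"
    by (simp_all add: penalty_decrease_def v_def g_def)
qed

text \<open>
  Near a given point the linearization error of a step is an arbitrarily small fraction of its
  length. It is therefore dominated by a predicted decrease that is bounded away from zero, and all
  short steps are accepted, uniformly over bounded directions and penalty parameters.
\<close>

lemma short_steps_accepted:
  fixes h :: "real^'n \<Rightarrow> real^'l"
  assumes C1: "twice_cont_diff f" "twice_cont_diff h" "twice_cont_diff G"
    and sym: "\<And>y. symmetric (G y)" and pos: "0 < c" "\<eta> < 1" "0 \<le> R" "0 \<le> P"
  shows "\<exists>\<tau>>0. \<forall>\<^sub>F x in nhds a. \<forall>d \<rho> u. norm d \<le> R \<longrightarrow> 0 \<le> \<rho> \<longrightarrow> \<rho> \<le> P \<longrightarrow>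
      c \<le> penalty_decrease f h G \<rho> x d \<longrightarrow> 0 \<le> u \<longrightarrow> u \<le> \<tau> \<longrightarrow> sufficient_decrease f h G \<eta> \<rho> x d u"
proof -
  obtain f' where f': "\<And>x. (f has_derivative blinfun_apply (f' x)) (at x)" "\<And>x. isCont f' x"
    using twice_cont_diff_imp_C1 [OF C1(1)] by blast
  obtain h' where h': "\<And>x. (h has_derivative blinfun_apply (h' x)) (at x)" "\<And>x. isCont h' x"
    using twice_cont_diff_imp_C1 [OF C1(2)] by blast
  obtain G' where G': "\<And>x. (G has_derivative blinfun_apply (G' x)) (at x)" "\<And>x. isCont G' x"
    using twice_cont_diff_imp_C1 [OF C1(3)] by blast
  \<comment> \<open>\<open>K\<close> sums the weights with which errors in \<open>f\<close>, \<open>h\<close> and \<open>G\<close> enter the penalty function, and \<open>e\<close> makes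
    the total error \<open>K * e * R\<close> per unit of step length at most the slack \<open>(1 - \<eta>) * c\<close>.\<close>
  define K where "K = P + real CARD('l) + 1"
  define e where "e = (1 - \<eta>) * c / (K * (R + 1))"
  have "0 < K" using pos by (simp add: K_def)
  then have "0 < e" using pos by (simp add: e_def)
  have eK: "e * K * R \<le> (1 - \<eta>) * c"
  proof -
    have "e * K * R = (1 - \<eta>) * c * (R / (R + 1))" using \<open>0 < K\<close> by (simp add: e_def)
    also have "\<dots> \<le> (1 - \<eta>) * c * 1" using pos by (intro mult_left_mono) auto
    finally show ?thesis by simp
  qed
  obtain rf where rf: "rf > 0" "\<And>x y. x \<in> ball a rf \<Longrightarrow> y \<in> ball a rf \<Longrightarrow>
      norm (f y - f x - f' x (y - x)) \<le> e * norm (y - x)"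
    using C1_uniform_linearization [OF f' \<open>0 < e\<close>, of a] by blast
  obtain rh where rh: "rh > 0" "\<And>x y. x \<in> ball a rh \<Longrightarrow> y \<in> ball a rh \<Longrightarrow>
      norm (h y - h x - h' x (y - x)) \<le> e * norm (y - x)"
    using C1_uniform_linearization [OF h' \<open>0 < e\<close>, of a] by blast
  obtain rG where rG: "rG > 0" "\<And>x y. x \<in> ball a rG \<Longrightarrow> y \<in> ball a rG \<Longrightarrow>
      norm (G y - G x - G' x (y - x)) \<le> e * norm (y - x)"
    using C1_uniform_linearization [OF G' \<open>0 < e\<close>, of a] by blast
  define m where "m = min rf (min rh rG)"
  have "0 < m" using rf rh rG by (simp add: m_def)
  \<comment> \<open>Steps of this length lead from the ball of radius \<open>m / 2\<close> into the ball of radius \<open>m\<close>.\<close>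
  define \<tau> where "\<tau> = min 1 (m / 2 / (R + 1))"
  have "0 < \<tau>" using \<open>0 < m\<close> pos by (simp add: \<tau>_def)
  have "sufficient_decrease f h G \<eta> \<rho> x d u"
    if x: "x \<in> ball a (m / 2)" and d: "norm d \<le> R" and \<rho>: "0 \<le> \<rho>" "\<rho> \<le> P"
      and c: "c \<le> penalty_decrease f h G \<rho> x d" and u: "0 \<le> u" "u \<le> \<tau>" for x d \<rho> u
  proof -
    let ?y = "x + u *\<^sub>R d"
    have "norm (u *\<^sub>R d) < m / 2"
    proof -
      have "norm (u *\<^sub>R d) \<le> \<tau> * R" using u d by (simp add: mult_mono)
      also have "\<dots> < \<tau> * (R + 1)" using \<open>0 < \<tau>\<close> by simp
      also have "\<dots> \<le> m / 2 / (R + 1) * (R + 1)" using pos by (intro mult_right_mono) (auto simp: \<tau>_def)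
      also have "\<dots> = m / 2"
        by (rule iffD1 [OF nonzero_eq_divide_eq refl]) (use pos in linarith)
      finally show ?thesis .
    qed
    then have "dist a ?y < m"
      using x norm_triangle_ineq4 [of "a - x" "u *\<^sub>R d"] by (simp add: dist_norm algebra_simps)
    then have in_ball: "x \<in> ball a rf" "?y \<in> ball a rf" "x \<in> ball a rh" "?y \<in> ball a rh"
        "x \<in> ball a rG" "?y \<in> ball a rG"
      using x \<open>0 < m\<close> by (auto simp: m_def)
    have "u \<le> 1" using u by (simp add: \<tau>_def)
    have ed: "e * norm (u *\<^sub>R d) \<le> e * (u * R)"
      using u d \<open>0 < e\<close> by (simp add: mult_left_mono)
    have ef: "norm (f ?y - f x - u * (grad f x \<bullet> d)) \<le> e * (u * R)"
      using rf(2) [OF in_ball(1,2)] ed by (simp add: grad_inner_eq [OF f'(1)] blinfun.scaleR_right)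
    have eh: "norm (h ?y - h x - u *\<^sub>R (Dh h x *v d)) \<le> e * (u * R)"
      using rh(2) [OF in_ball(3,4)] ed by (simp add: Dh_mult_eq [OF h'(1)] blinfun.scaleR_right)
    have eG: "norm (G ?y - G x - u *\<^sub>R DG G x d) \<le> e * (u * R)"
      using rG(2) [OF in_ball(5,6)] ed by (simp add: DG_eq [OF G'(1)] blinfun.scaleR_right)
    have symD: "symmetric (DG G x d)"
      using symmetric_derivative [OF sym G'(1)] by (simp add: DG_eq [OF G'(1)])
    have nn: "0 \<le> e * (u * R)" using \<open>0 < e\<close> u pos by simp
    have "\<rho> * (f ?y - f x - u * (grad f x \<bullet> d)) \<le> \<rho> * (e * (u * R))"
      using ef \<rho> by (intro mult_left_mono) auto
    also have "\<rho> * (e * (u * R)) \<le> P * (e * (u * R))"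
      using \<rho> nn by (intro mult_right_mono) auto
    finally have ef_P: "\<rho> * (f ?y - f x - u * (grad f x \<bullet> d)) \<le> P * (e * (u * R))" .
    have eh_L: "real CARD('l) * norm (h ?y - h x - u *\<^sub>R (Dh h x *v d)) \<le> real CARD('l) * (e * (u * R))"
      using eh by (intro mult_left_mono) auto
    have "penalty f h G \<rho> ?y - penalty f h G \<rho> x
        \<le> - u * penalty_decrease f h G \<rho> x d + K * (e * (u * R))"
    proof -
      have "\<rho> * f ?y - \<rho> * f x = \<rho> * (f ?y - f x - u * (grad f x \<bullet> d)) + u * (\<rho> * (grad f x \<bullet> d))"
        by (simp add: algebra_simps)
      moreover have "- u * penalty_decrease f h G \<rho> x d
          = u * (\<rho> * (grad f x \<bullet> d)) - u * violation_decrease h G x d"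
        by (simp add: penalty_decrease_def algebra_simps)
      moreover have "K * (e * (u * R)) = P * (e * (u * R)) + real CARD('l) * (e * (u * R)) + e * (u * R)"
        by (simp add: K_def algebra_simps)
      ultimately show ?thesis
        using violation_step_le [where h = h, OF sym symD u(1) \<open>u \<le> 1\<close>] eG ef_P eh_L
        unfolding penalty_def by linarith
    qed
    also have "K * (e * (u * R)) \<le> (1 - \<eta>) * u * penalty_decrease f h G \<rho> x d"
    proof -
      have "e * K * R \<le> (1 - \<eta>) * penalty_decrease f h G \<rho> x d"
        using eK c pos(2) mult_left_mono [of c "penalty_decrease f h G \<rho> x d" "1 - \<eta>"] by linarith
      from mult_left_mono [OF this u(1)] show ?thesis by (simp add: mult_ac)
    qed
    finally show ?thesis by (simp add: sufficient_decrease_def algebra_simps)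
  qed
  moreover have "\<forall>\<^sub>F x in nhds a. x \<in> ball a (m / 2)"
    using \<open>0 < m\<close> by (intro eventually_nhds_in_open) auto
  ultimately show ?thesis
    using \<open>0 < \<tau>\<close> by (intro exI [of _ \<tau>] conjI) (auto elim!: eventually_mono)
qed

text \<open>Backtracking overshoots the threshold \<open>\<tau>\<close> by at most one reduction.\<close>

lemma backtracking_step_ge:
  fixes \<gamma> :: real
  assumes "0 < \<gamma>" "\<gamma> < 1" "\<forall>i<j. \<not> Q (\<gamma> ^ i)" "\<And>u. 0 \<le> u \<Longrightarrow> u \<le> \<tau> \<Longrightarrow> Q u"
  shows "min 1 (\<gamma> * \<tau>) \<le> \<gamma> ^ j"
proof (cases j)
  case (Suc i)
  then have "\<tau> < \<gamma> ^ i" using assms by (meson lessI linorder_not_le zero_le_power less_imp_le)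
  then have "\<gamma> * \<tau> \<le> \<gamma> * \<gamma> ^ i" using assms(1) by simp
  then show ?thesis using Suc by (simp add: min.coboundedI2)
qed simp

section \<open>Infeasible stationary points\<close>

text \<open>
  The multipliers of an infeasible stationary point cannot vanish: where a constraint is violated,
  the complementarity conditions force a component of \<open>\<mu>\<close> to be \<open>1\<close> or \<open>-1\<close>, or \<open>Y\<close> to have trace \<open>1\<close>.
\<close>

lemma infeasible_stationary_multipliers_nonzero:
  assumes "violation h G x > 0"
    and "(1 - \<mu>) * pos_part (h x) = 0" "(1 + \<mu>) * neg_part (h x) = 0"
    and "(1 - trace Y) * max 0 (max_eigenvalue (G x)) = 0"
  shows "(\<mu>, Y) \<noteq> (0, 0)"
proof
  assume "(\<mu>, Y) = (0, 0)"
  then have "pos_part (h x) = 0" "neg_part (h x) = 0" "max 0 (max_eigenvalue (G x)) = 0"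
    using assms(2-4) by (auto simp: trace_def)
  moreover have "l1_norm (h x) = (\<Sum>i\<in>UNIV. pos_part (h x) $ i - neg_part (h x) $ i)"
    by (auto simp: l1_norm_def pos_part_def neg_part_def intro!: sum.cong)
  ultimately have "violation h G x = 0" by (simp add: violation_def)
  then show False using assms(1) by simp
qed

lemma inner_vector_matrix_mult: "w \<bullet> (y v* A) = y \<bullet> (A *v w)" for w :: "real^'n"
  by (simp add: inner_commute [of w] dot_lmul_matrix)

text \<open>With multiplier \<open>0\<close> for the objective, stationarity of the violation is the Fritz John condition.\<close>

lemma infeasible_stationary_imp_fritz_john:
  assumes sym: "symmetric (G x)" and st: "infeasible_stationary h G x"
  shows "fritz_john_shifted f h G (least_shift h G x) x"
proof -
  obtain \<mu> Y where *: "transpose (Dh h x) *v \<mu> + DG_adj G x Y = 0"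
    "(1 - \<mu>) * pos_part (h x) = 0" "(1 + \<mu>) * neg_part (h x) = 0"
    "(1 - trace Y) * max 0 (max_eigenvalue (G x)) = 0"
    "mat_inner Y (G x - max 0 (max_eigenvalue (G x)) *\<^sub>R mat 1) = 0" "pos_semidef Y"
    using st unfolding infeasible_stationary_def by blast
  have "(0, \<mu>, Y) \<noteq> (0, 0, 0)"
    using infeasible_stationary_multipliers_nonzero [of h G x \<mu> Y] * st
    by (auto simp: infeasible_stationary_def)
  moreover have "h x = pos_part (h x) - - neg_part (h x)"
    by (auto simp: vec_eq_iff pos_part_def neg_part_def)
  moreover have "G x \<preceq>\<^sub>L max 0 (max_eigenvalue (G x)) *\<^sub>R mat 1"
    by (simp add: loewner_le_scaled_identity_iff [OF sym])
  ultimately show ?thesis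
    unfolding fritz_john_shifted_def least_shift_def prod.case using *
    by (intro exI [of _ 0] exI [of _ \<mu>] exI [of _ Y]) simp
qed

text \<open>
  A direction as in Robinson's qualification pairs \<open>Y\<close> to zero with a positive definite matrix,
  which forces \<open>Y = 0\<close>; then full row rank forces \<open>\<mu> = 0\<close>.
\<close>

lemma infeasible_stationary_imp_not_robinson:
  fixes h :: "real^'n \<Rightarrow> real^'l"
  assumes st: "infeasible_stationary h G x"
  shows "\<not> robinson_cq_shifted h G (least_shift h G x) x"
proof
  assume "robinson_cq_shifted h G (least_shift h G x) x"
  define t where "t = max 0 (max_eigenvalue (G x))"
  obtain d where rank: "rank (Dh h x) = CARD('l)"
    and d: "Dh h x *v d = 0" "G x + DG G x d \<prec>\<^sub>L t *\<^sub>R mat 1"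
    using \<open>robinson_cq_shifted h G _ x\<close> by (auto simp: robinson_cq_shifted_def least_shift_def t_def)
  obtain \<mu> Y where *: "transpose (Dh h x) *v \<mu> + DG_adj G x Y = 0"
    "(1 - \<mu>) * pos_part (h x) = 0" "(1 + \<mu>) * neg_part (h x) = 0"
    "(1 - trace Y) * max 0 (max_eigenvalue (G x)) = 0"
    "mat_inner Y (G x - t *\<^sub>R mat 1) = 0" "pos_semidef Y"
    using st unfolding infeasible_stationary_def t_def by blast
  have symY: "symmetric Y" using *(6) by (simp add: pos_semidef_def)
  have "0 = d \<bullet> (transpose (Dh h x) *v \<mu> + DG_adj G x Y)" unfolding *(1) by simp
  also have "\<dots> = \<mu> \<bullet> (Dh h x *v d) + mat_inner (DG G x d) Y"
    by (simp add: inner_add_right inner_DG_adj inner_vector_matrix_mult)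
  finally have "mat_inner (DG G x d) Y = 0" using d(1) by simp
  then have "Y \<bullet> DG G x d = 0"
    using symY by (simp add: mat_inner_eq_inner inner_commute)
  then have "Y \<bullet> (t *\<^sub>R mat 1 - (G x + DG G x d)) = 0"
    using *(5) symY by (simp add: mat_inner_eq_inner inner_diff_right inner_add_right)
  then have "Y = 0"
    using psd_inner_posdef_eq_0 *(6) d(2) unfolding loewner_less_def by blast
  then have "transpose (Dh h x) *v \<mu> = transpose (Dh h x) *v 0"
    using *(1) by (simp add: DG_adj_def mat_inner_def trace_def vec_eq_iff matrix_matrix_mult_def)
  moreover have "inj ((*v) (transpose (Dh h x)))"
    using rank by (simp only: full_rank_injective [symmetric] rank_transpose)
  ultimately have "\<mu> = 0" by (rule injD [rotated])
  then show False
    using infeasible_stationary_multipliers_nonzero [of h G x \<mu> Y] * st \<open>Y = 0\<close>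
    by (auto simp: infeasible_stationary_def)
qed

lemma norm_le_inner_1:
  assumes "0 \<le> (r :: real^'l)"
  shows "norm r \<le> 1 \<bullet> r"
  using norm_le_l1_cart [of r] assms by (simp add: inner_vec_def less_eq_vec_def)

lemma LIMSEQ_vec_le:
  fixes X Y :: "nat \<Rightarrow> real^'l"
  assumes "X \<longlonglongrightarrow> a" "Y \<longlonglongrightarrow> b" "\<And>i. X i \<le> Y i"
  shows "a \<le> b"
  unfolding less_eq_vec_def
proof
  fix j
  show "a $ j \<le> b $ j"
    by (rule LIMSEQ_le [OF tendsto_vec_nth [OF assms(1)] tendsto_vec_nth [OF assms(2)]])
       (use assms(3) in \<open>simp add: less_eq_vec_def\<close>)
qed

lemma pos_semidef_limit:
  assumes "A \<longlonglongrightarrow> L" "\<And>i. pos_semidef (A i)"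
  shows "pos_semidef L"
  unfolding pos_semidef_def
proof (intro conjI allI)
  have "L $ i $ j = L $ j $ i" for i j
  proof (rule LIMSEQ_unique)
    show "(\<lambda>k. A k $ i $ j) \<longlonglongrightarrow> L $ i $ j" by (intro tendsto_intros assms)
    have "A k $ i $ j = A k $ j $ i" for k
      using assms(2) symmetric_nth unfolding pos_semidef_def by metis
    moreover have "(\<lambda>k. A k $ j $ i) \<longlonglongrightarrow> L $ j $ i" by (intro tendsto_intros assms)
    ultimately show "(\<lambda>k. A k $ i $ j) \<longlonglongrightarrow> L $ j $ i" by simp
  qed
  then show "symmetric L" by (simp add: symmetric_def transpose_def vec_eq_iff)
  fix w
  have "(\<lambda>k. outer w \<bullet> A k) \<longlonglongrightarrow> outer w \<bullet> L" by (intro tendsto_intros assms)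
  then have "0 \<le> outer w \<bullet> L"
    by (rule LIMSEQ_le_const) (use assms(2) in \<open>auto simp: inner_outer pos_semidef_def\<close>)
  then show "0 \<le> w \<bullet> (L *v w)" by (simp add: inner_outer)
qed

text \<open>
  Complementarity identifies the shift \<open>(r, s, t)\<close> in a KKT point of the first subproblem with step
  \<open>0\<close> as the least one, which turns the KKT conditions into stationarity of the violation.
\<close>

lemma kkt_with_zero_step_imp_infeasible_stationary:
  fixes h :: "real^'n \<Rightarrow> real^'l"
  assumes "violation h G x > 0" "symmetric (G x)"
    and der: "(h has_derivative h') (at x)" "(G has_derivative G') (at x)"
    and stat: "\<And>w. \<mu> \<bullet> h' w + Y \<bullet> G' w = 0"
    and feas: "h x = r - s" "max_eigenvalue (G x) \<le> t" "0 \<le> r" "0 \<le> s" "0 \<le> t"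
    and comp: "\<And>j. (1 - \<mu> $ j) * r $ j = 0" "\<And>j. (1 + \<mu> $ j) * s $ j = 0" "(1 - trace Y) * t = 0"
      "Y \<bullet> (G x - t *\<^sub>R mat 1) = 0"
    and mult: "- 1 \<le> \<mu>" "\<mu> \<le> 1" "pos_semidef Y" "trace Y \<le> 1"
  shows "infeasible_stationary h G x"
proof -
  have symY: "symmetric Y" using mult(3) by (simp add: pos_semidef_def)
  have rs: "r $ j = 0 \<or> s $ j = 0" "0 \<le> r $ j" "0 \<le> s $ j" for j
    using comp(1,2) [of j] feas(3,4) by (auto simp: less_eq_vec_def)
  have "pos_part (h x) = r"
    unfolding vec_eq_iff
  proof
    fix j show "pos_part (h x) $ j = r $ j"
      using rs [of j] by (auto simp: pos_part_def feas(1))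
  qed
  moreover have "neg_part (h x) = - s"
    unfolding vec_eq_iff
  proof
    fix j show "neg_part (h x) $ j = (- s) $ j"
      using rs [of j] by (auto simp: neg_part_def feas(1))
  qed
  moreover have "max 0 (max_eigenvalue (G x)) = t"
  proof (cases "t = 0")
    case True
    then show ?thesis using feas(2) by simp
  next
    case False
    then have tr: "Y \<bullet> mat 1 = 1" using comp(3) by (simp add: trace_eq_inner)
    have "pos_semidef (max_eigenvalue (G x) *\<^sub>R mat 1 - G x)"
      using loewner_le_scaled_identity_iff [OF assms(2), of "max_eigenvalue (G x)"]
      by (simp add: loewner_le_def)
    from psd_inner_nonneg [OF mult(3) this] have "t \<le> max_eigenvalue (G x)"
      using comp(4) tr by (simp add: inner_diff_right)
    then show ?thesis using feas(2,5) by simp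
  qed
  moreover have "transpose (Dh h x) *v \<mu> + DG_adj G x Y = 0"
  proof -
    have "w \<bullet> (transpose (Dh h x) *v \<mu> + DG_adj G x Y) = \<mu> \<bullet> h' w + Y \<bullet> G' w" for w
      using symY Dh_mult_eq [OF der(1), of w] DG_eq [OF der(2), of w]
      by (simp add: inner_add_right inner_DG_adj mat_inner_eq_inner inner_vector_matrix_mult
          inner_commute [of Y])
    then show ?thesis using stat by (metis inner_eq_zero_iff)
  qed
  ultimately show ?thesis
    unfolding infeasible_stationary_def
    using assms(1) comp mult symY
    by (intro conjI exI [of _ \<mu>] exI [of _ Y]) (auto simp: vec_eq_iff mat_inner_eq_inner)
qed

text \<open>
  The multipliers of the first subproblem are bounded, so its KKT conditions survive the passage to
  the limit along a subsequence.
\<close>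

lemma vanishing_feasibility_steps_imp_infeasible_stationary:
  fixes h :: "real^'n \<Rightarrow> real^'l" and G :: "real^'n \<Rightarrow> real^'m^'m"
  assumes C1: "twice_cont_diff h" "twice_cont_diff G" and sym: "\<And>y. symmetric (G y)"
    and lim: "X \<longlonglongrightarrow> a" "D \<longlonglongrightarrow> 0" and pos: "violation h G a > 0"
    and sol: "\<And>i. fea_solution h G (X i) (B i) (D i, r i, s i, t i)"
    and mult: "\<And>i. fea_multipliers h G (X i) (B i) (D i, r i, s i, t i) (\<mu> i) (Y i)"
    and B: "\<And>i. pos_semidef (B i)" "\<And>i w. w \<bullet> (B i *v w) \<le> b * (norm w)\<^sup>2" "0 \<le> b"
  shows "infeasible_stationary h G a"
proof -
  obtain h' where h': "\<And>x. (h has_derivative blinfun_apply (h' x)) (at x)" "\<And>x. isCont h' x"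
    using twice_cont_diff_imp_C1 [OF C1(1)] by blast
  obtain G' where G': "\<And>x. (G has_derivative blinfun_apply (G' x)) (at x)" "\<And>x. isCont G' x"
    using twice_cont_diff_imp_C1 [OF C1(2)] by blast
  have contG: "isCont G a" and conth: "isCont h a"
    using h'(1) G'(1) has_derivative_continuous by blast+
  have feas: "fea_feasible h G (X i) (D i, r i, s i, t i)" for i
    using sol by (simp add: fea_solution_def)
  then have nn: "0 \<le> r i" "0 \<le> s i" "0 \<le> t i" for i by (simp_all add: fea_feasible_def)
  have symB: "symmetric (B i)" for i using B(1) by (simp add: pos_semidef_def)
  have psd: "pos_semidef (Y i)" for i using mult [of i] by (simp add: fea_multipliers_def)
  note kkt = fea_multipliers_kkt [OF mult feas symB h'(1) G'(1)]
  have "(\<lambda>i. violation h G (X i)) \<longlonglongrightarrow> violation h G a"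
    using isCont_violation [OF conth contG sym] lim(1) isCont_tendsto_compose by blast
  then obtain V where V: "\<And>i. violation h G (X i) \<le> V"
    by (metis BseqE abs_le_D1 convergentI convergent_imp_Bseq real_norm_def)
  have "1 \<bullet> r i + 1 \<bullet> s i + t i \<le> V" for i
    using fea_solution_objective_le [OF sym sol [of i]] V [of i] B(1) [of i]
    by (auto simp: pos_semidef_def inner_add_right intro: order_trans [rotated])
  moreover have "norm (r i) \<le> 1 \<bullet> r i" "norm (s i) \<le> 1 \<bullet> s i" for i
    using norm_le_inner_1 nn by auto
  ultimately have rst: "norm (r i) \<le> V" "norm (s i) \<le> V" "norm (t i) \<le> V" for i
    using nn(3) [of i] norm_ge_zero [of "r i"] norm_ge_zero [of "s i"] by (smt (verit) real_norm_def)+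
  have \<mu>: "norm (\<mu> i) \<le> real CARD('l)" for i
  proof -
    have "\<bar>\<mu> i $ j\<bar> \<le> 1" for j
      using kkt(5,6) [of i] by (simp add: less_eq_vec_def abs_le_iff minus_le_iff)
    then have "(\<Sum>j\<in>UNIV. \<bar>\<mu> i $ j\<bar>) \<le> real CARD('l)"
      using sum_bounded_above [of UNIV "\<lambda>j. \<bar>\<mu> i $ j\<bar>" 1] by simp
    then show ?thesis using norm_le_l1_cart [of "\<mu> i"] by linarith
  qed
  have Y: "norm (Y i) \<le> 1" for i
    using psd_norm_le_trace [OF psd [of i]] kkt(7) [of i] by linarith
  define z where "z = (\<lambda>i. (\<mu> i, Y i, r i, s i, t i))"
  have "norm (z i) \<le> real CARD('l) + (1 + (V + (V + V)))" for i
    unfolding z_def using \<mu> Y rst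
    by (intro order_trans [OF norm_Pair_le] add_mono) auto
  then have "bounded (range z)" by (auto simp: bounded_iff)
  then obtain l q where q: "strict_mono q" "(z \<circ> q) \<longlonglongrightarrow> l"
    using bounded_imp_convergent_subsequence by blast
  obtain \<mu>' Y' r' s' t' where l: "l = (\<mu>', Y', r', s', t')" by (metis prod.exhaust)
  have tend: "(\<lambda>i. \<mu> (q i)) \<longlonglongrightarrow> \<mu>'" "(\<lambda>i. Y (q i)) \<longlonglongrightarrow> Y'" "(\<lambda>i. r (q i)) \<longlonglongrightarrow> r'"
    "(\<lambda>i. s (q i)) \<longlonglongrightarrow> s'" "(\<lambda>i. t (q i)) \<longlonglongrightarrow> t'"
    using tendsto_fst [OF q(2)] tendsto_fst [OF tendsto_snd [OF q(2)]]
      tendsto_fst [OF tendsto_snd [OF tendsto_snd [OF q(2)]]]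
      tendsto_fst [OF tendsto_snd [OF tendsto_snd [OF tendsto_snd [OF q(2)]]]]
      tendsto_snd [OF tendsto_snd [OF tendsto_snd [OF tendsto_snd [OF q(2)]]]]
    by (simp_all add: z_def l comp_def)
  have X: "(\<lambda>i. X (q i)) \<longlonglongrightarrow> a" and D: "(\<lambda>i. D (q i)) \<longlonglongrightarrow> 0"
    using LIMSEQ_subseq_LIMSEQ [OF lim(1) q(1)] LIMSEQ_subseq_LIMSEQ [OF lim(2) q(1)]
    by (simp_all add: comp_def)
  have hX: "(\<lambda>i. h (X (q i))) \<longlonglongrightarrow> h a" and GX: "(\<lambda>i. G (X (q i))) \<longlonglongrightarrow> G a"
    and hX': "(\<lambda>i. h' (X (q i))) \<longlonglongrightarrow> h' a" and GX': "(\<lambda>i. G' (X (q i))) \<longlonglongrightarrow> G' a"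
    using X conth contG h'(2) G'(2) isCont_tendsto_compose by blast+
  have GD: "(\<lambda>i. G (X (q i)) + G' (X (q i)) (D (q i))) \<longlonglongrightarrow> G a"
    using tendsto_add [OF GX bounded_bilinear.tendsto [OF bounded_bilinear_blinfun_apply GX' D]]
    by (simp add: blinfun.zero_right)
  show ?thesis
  proof (rule kkt_with_zero_step_imp_infeasible_stationary [OF pos sym h'(1) G'(1)])
    show "\<mu>' \<bullet> h' a w + Y' \<bullet> G' a w = 0" for w
    proof -
      have "(\<lambda>i. w \<bullet> (B (q i) *v D (q i))) \<longlonglongrightarrow> 0"
      proof (rule Lim_null_comparison)
        show "\<forall>\<^sub>F i in sequentially. norm (w \<bullet> (B (q i) *v D (q i))) \<le> norm w * (b * norm (D (q i)))"
          unfolding real_norm_def using norm_psd_mult_le [OF B(1,2,3)]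
          by (intro always_eventually allI order_trans [OF Cauchy_Schwarz_ineq2] mult_left_mono) auto
        show "(\<lambda>i. norm w * (b * norm (D (q i)))) \<longlonglongrightarrow> 0"
          using tendsto_mult_left [OF tendsto_mult_left [OF tendsto_norm [OF D]], of "norm w" b] by simp
      qed
      moreover have "(\<lambda>i. \<mu> (q i) \<bullet> h' (X (q i)) w + Y (q i) \<bullet> G' (X (q i)) w)
          \<longlonglongrightarrow> \<mu>' \<bullet> h' a w + Y' \<bullet> G' a w"
        by (intro tendsto_intros tend bounded_bilinear.tendsto [OF bounded_bilinear_blinfun_apply]
            hX' GX')
      ultimately have "(\<lambda>i. w \<bullet> (B (q i) *v D (q i)) + (\<mu> (q i) \<bullet> h' (X (q i)) w + Y (q i) \<bullet> G' (X (q i)) w))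
          \<longlonglongrightarrow> 0 + (\<mu>' \<bullet> h' a w + Y' \<bullet> G' a w)"
        by (rule tendsto_add)
      moreover have "w \<bullet> (B (q i) *v D (q i)) + (\<mu> (q i) \<bullet> h' (X (q i)) w + Y (q i) \<bullet> G' (X (q i)) w) = 0" for i
        using kkt(1) [of w "q i"] by (simp add: add.assoc)
      ultimately show ?thesis by (simp add: LIMSEQ_const_iff)
    qed
    have "h (X i) + h' (X i) (D i) = r i - s i" for i
      using feas [of i] by (simp add: fea_feasible_def Dh_mult_eq [OF h'(1)])
    moreover have "(\<lambda>i. h (X (q i)) + h' (X (q i)) (D (q i))) \<longlonglongrightarrow> h a"
      using tendsto_add [OF hX bounded_bilinear.tendsto [OF bounded_bilinear_blinfun_apply hX' D]]
      by (simp add: blinfun.zero_right)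
    ultimately show "h a = r' - s'"
      using tendsto_diff [OF tend(3,4)] by (simp add: LIMSEQ_unique)
    have symGD: "symmetric (G (X i) + G' (X i) w)" for i w
      by (intro symmetric_add sym symmetric_derivative [OF sym G'(1)])
    have le_t: "max_eigenvalue (G (X i) + G' (X i) (D i)) \<le> t i" for i
      using feas [of i] loewner_le_scaled_identity_iff [OF symGD]
      by (simp add: fea_feasible_def DG_eq [OF G'(1)])
    show "max_eigenvalue (G a) \<le> t'"
      by (rule LIMSEQ_le [OF tendsto_max_eigenvalue [OF GD symGD sym] tend(5)]) (simp add: le_t)
    show "0 \<le> t'" using tend(5) by (rule LIMSEQ_le_const) (simp add: nn)
    show "0 \<le> r'" "0 \<le> s'"
      using nn by (auto intro: LIMSEQ_vec_le [OF tendsto_const tend(3)] LIMSEQ_vec_le [OF tendsto_const tend(4)])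
    show "(1 - \<mu>' $ j) * r' $ j = 0" for j
    proof -
      have "(\<lambda>i. (1 - \<mu> (q i) $ j) * r (q i) $ j) \<longlonglongrightarrow> (1 - \<mu>' $ j) * r' $ j"
        by (intro tendsto_intros tend)
      moreover have "(1 - \<mu> i $ j) * r i $ j = 0" for i
        using arg_cong [OF kkt(2), of "\<lambda>y. y $ j"] by simp
      ultimately show ?thesis by (simp only: LIMSEQ_const_iff)
    qed
    show "(1 + \<mu>' $ j) * s' $ j = 0" for j
    proof -
      have "(\<lambda>i. (1 + \<mu> (q i) $ j) * s (q i) $ j) \<longlonglongrightarrow> (1 + \<mu>' $ j) * s' $ j"
        by (intro tendsto_intros tend)
      moreover have "(1 + \<mu> i $ j) * s i $ j = 0" for i
        using arg_cong [OF kkt(3), of "\<lambda>y. y $ j"] by simp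
      ultimately show ?thesis by (simp only: LIMSEQ_const_iff)
    qed
    have tr: "(\<lambda>i. trace (Y (q i))) \<longlonglongrightarrow> trace Y'"
      unfolding trace_eq_inner by (intro tendsto_intros tend)
    have "(\<lambda>i. (1 - trace (Y (q i))) * t (q i)) \<longlonglongrightarrow> (1 - trace Y') * t'"
      by (intro tendsto_intros tend tr)
    then show "(1 - trace Y') * t' = 0" unfolding kkt(4) LIMSEQ_const_iff by simp
    have "Y i \<bullet> (G (X i) + G' (X i) (D i) - t i *\<^sub>R mat 1) = 0" for i
      using mult [of i] mat_inner_eq_inner(1) [of "Y i"] psd [of i]
      by (simp add: fea_multipliers_def DG_eq [OF G'(1)] pos_semidef_def)
    moreover have "(\<lambda>i. Y (q i) \<bullet> (G (X (q i)) + G' (X (q i)) (D (q i)) - t (q i) *\<^sub>R mat 1))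
        \<longlonglongrightarrow> Y' \<bullet> (G a - t' *\<^sub>R mat 1)"
      by (intro tendsto_intros tend GD)
    ultimately show "Y' \<bullet> (G a - t' *\<^sub>R mat 1) = 0" by (simp add: LIMSEQ_const_iff)
    show "- 1 \<le> \<mu>'" "\<mu>' \<le> 1"
      using kkt(5,6) by (auto intro: LIMSEQ_vec_le [OF tendsto_const tend(1)] LIMSEQ_vec_le [OF tend(1) tendsto_const])
    show "pos_semidef Y'" using tend(2) psd by (rule pos_semidef_limit)
    show "trace Y' \<le> 1" using tr by (rule LIMSEQ_le_const2) (use kkt(7) in auto)
  qed
qed

section \<open>Accumulation points of the iterates\<close>

theorem theorem18:
  fixes f :: "real^'n \<Rightarrow> real"
    and h :: "real^'n \<Rightarrow> real^'l"
    and G :: "real^'n \<Rightarrow> real^'m^'m"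
    and \<epsilon> \<delta> \<eta> \<gamma> b1 b2 vlim :: real
    and Bfea B :: "nat \<Rightarrow> real^'n^'n"
    and x dfea d :: "nat \<Rightarrow> real^'n"
    and \<rho> t :: "nat \<Rightarrow> real"
    and r s \<mu>b \<mu>h :: "nat \<Rightarrow> real^'l"
    and Yb Yh :: "nat \<Rightarrow> real^'m^'m"
    and \<Omega> :: "(real^'n) set"
    and K\<rho> :: "nat set"
    and \<phi> :: "nat \<Rightarrow> nat"
    and xstar :: "real^'n"
  assumes G_symmetric: "\<And>y. symmetric (G y)"
    and constants: "\<epsilon> \<in> {0<..<1}" "\<delta> \<in> {0<..<1}" "\<eta> \<in> {0<..<1}" "\<gamma> \<in> {0<..<1}"
    and run: "sqp_run f h G \<epsilon> \<delta> \<eta> \<gamma> Bfea B x \<rho> dfea r s t \<mu>b Yb d \<mu>h Yh"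
    and A1: "twice_cont_diff f" "twice_cont_diff h" "twice_cont_diff G"
    and A2: "convex \<Omega>" "compact \<Omega>" "\<And>k. x k \<in> \<Omega>"
    and A3: "0 < b1" "b1 < b2"
      "\<And>k w. b1 * (norm w)\<^sup>2 \<le> w \<bullet> (Bfea k *v w) \<and> w \<bullet> (Bfea k *v w) \<le> b2 * (norm w)\<^sup>2"
      "\<And>k w. b1 * (norm w)\<^sup>2 \<le> w \<bullet> (B k *v w) \<and> w \<bullet> (B k *v w) \<le> b2 * (norm w)\<^sup>2"
    and rho_lim: "\<rho> \<longlonglongrightarrow> 0"
    and v_lim: "(\<lambda>k. violation h G (x k)) \<longlonglongrightarrow> vlim" "vlim > 0"
    and K_def: "K\<rho> = {k. \<rho> (Suc k) < \<rho> k}"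
    and accumulation: "strict_mono \<phi>" "\<And>i. \<phi> i \<in> K\<rho>" "(\<lambda>i. x (\<phi> i)) \<longlonglongrightarrow> xstar"
  shows "infeasible_stationary h G xstar \<and>
         fritz_john_shifted f h G (least_shift h G xstar) xstar \<and>
         \<not> robinson_cq_shifted h G (least_shift h G xstar) xstar"
proof -
  obtain f' where f': "\<And>y. (f has_derivative blinfun_apply (f' y)) (at y)" "\<And>y. isCont f' y"
    using twice_cont_diff_imp_C1 [OF A1(1)] by blast
  obtain h' where h': "\<And>y. (h has_derivative blinfun_apply (h' y)) (at y)" "\<And>y. isCont h' y"
    using twice_cont_diff_imp_C1 [OF A1(2)] by blast
  obtain G' where G': "\<And>y. (G has_derivative blinfun_apply (G' y)) (at y)" "\<And>y. isCont G' y"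
    using twice_cont_diff_imp_C1 [OF A1(3)] by blast
  have iter: "pos_def (Bfea k)"
    "fea_solution h G (x k) (Bfea k) (dfea k, r k, s k, t k)"
    "fea_multipliers h G (x k) (Bfea k) (dfea k, r k, s k, t k) (\<mu>b (Suc k)) (Yb (Suc k))"
    "opt_solution f h G (x k) (\<rho> k) (B k) (r k) (s k) (t k) (d k)"
    "opt_multipliers f h G (x k) (\<rho> k) (B k) (r k) (s k) (t k) (d k) (\<mu>h (Suc k)) (Yh (Suc k))"
    "\<rho> (Suc k) = decrease_update f h G \<epsilon> \<delta> (x k) (B k) (d k) (multiplier_update \<epsilon> \<delta> (\<rho> k)
      (mult_size (\<mu>b (Suc k)) (Yb (Suc k))) (mult_size (\<mu>h (Suc k)) (Yh (Suc k))))"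
    "\<exists>j. sufficient_decrease f h G \<eta> (\<rho> (Suc k)) (x k) (d k) (\<gamma> ^ j) \<and>
      (\<forall>i<j. \<not> sufficient_decrease f h G \<eta> (\<rho> (Suc k)) (x k) (d k) (\<gamma> ^ i)) \<and>
      x (Suc k) = x k + (\<gamma> ^ j) *\<^sub>R d k" for k
    using run unfolding sqp_run_def by blast+
  have sym_DG: "symmetric (DG G y w)" for y w
    using symmetric_derivative [OF G_symmetric G'(1)] by (simp add: DG_eq [OF G'(1)])
  have b2: "0 \<le> b2" using A3 by simp
  have psd_Bfea: "pos_semidef (Bfea k)" for k
    using iter(1) by (rule pos_def_imp_pos_semidef)
  have nonneg_B: "0 \<le> w \<bullet> (B k *v w)" for w k
    using run pos_def_imp_pos_semidef [of "B k"] by (simp add: sqp_run_def pos_semidef_def)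
  have opt_feas: "opt_feasible h G (x k) (r k) (s k) (t k) (d k)"
    "opt_feasible h G (x k) (r k) (s k) (t k) (dfea k)" for k
    using iter(2,4) [of k] by (auto simp: opt_solution_def fea_solution_def fea_feasible_def opt_feasible_def)

  define v where "v k = violation h G (x k)" for k
  define vdec where "vdec k = violation_decrease h G (x k) (d k)" for k
  define pdec where "pdec k = penalty_decrease f h G (\<rho> (Suc k)) (x k) (d k)" for k

  \<comment> \<open>The feasibility steps tend to zero wherever the predicted decrease of the violation does.\<close>
  have dfea_vdec: "b1 / 2 * (norm (dfea k))\<^sup>2 \<le> vdec k" for k
    using violation_decrease_ge [OF G_symmetric sym_DG iter(2) opt_feas(1), of k] A3(3) [of "dfea k" k]
    by (simp add: vdec_def)
  have vdec_nonneg: "0 \<le> vdec k" for k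
    using dfea_vdec [of k] A3(1) by (meson divide_nonneg_pos less_imp_le mult_nonneg_nonneg
        order_trans zero_le_power2 zero_less_numeral)
  have rho_step: "0 \<le> \<rho> (Suc k) \<and> \<epsilon> * vdec k \<le> pdec k" if "0 \<le> \<rho> k" for k
  proof -
    have size: "0 \<le> mult_size (\<mu>b (Suc k)) (Yb (Suc k))" "0 \<le> mult_size (\<mu>h (Suc k)) (Yh (Suc k))"
      using iter(3,5) [of k] by (auto simp: mult_size_def fea_multipliers_def opt_multipliers_def
          infnorm_pos_le psd_trace_nonneg intro!: add_nonneg_nonneg)
    have "0 \<le> multiplier_update \<epsilon> \<delta> (\<rho> k) (mult_size (\<mu>b (Suc k)) (Yb (Suc k)))
        (mult_size (\<mu>h (Suc k)) (Yh (Suc k)))"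
      by (rule multiplier_update_nonneg) (use that size constants in auto)
    from decrease_update_properties [OF this, of \<epsilon> \<delta> h G "x k" "d k" "B k" f]
    show ?thesis
      using constants vdec_nonneg [of k] nonneg_B by (simp add: vdec_def pdec_def flip: iter(6))
  qed
  have rho_nonneg: "0 \<le> \<rho> k" for k
  proof (induction k)
    case 0
    then show ?case using run by (simp add: sqp_run_def)
  next
    case (Suc k)
    then show ?case using rho_step by blast
  qed
  have vdec_pdec: "\<epsilon> * vdec k \<le> pdec k" for k using rho_step rho_nonneg by blast
  have pdec_nonneg: "0 \<le> pdec k" for k
    using vdec_pdec [of k] mult_nonneg_nonneg [OF _ vdec_nonneg [of k], of \<epsilon>] constants(1) by simp

  have "Bseq \<rho>" "Bseq v"
    using rho_lim v_lim(1) unfolding v_def by (blast intro: convergentI convergent_imp_Bseq)+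
  then obtain P V where P: "0 \<le> P" "\<And>k. \<bar>\<rho> k\<bar> \<le> P" and V: "\<And>k. \<bar>v k\<bar> \<le> V"
    unfolding Bseq_def real_norm_def using less_imp_le by blast
  have "isCont f y" for y using f'(1) by (rule has_derivative_continuous)
  then have "compact (f ` \<Omega>)" "compact (f' ` \<Omega>)"
    using A2(2) f'(2) by (auto intro!: compact_continuous_image continuous_at_imp_continuous_on)
  then have "bounded (f ` \<Omega>)" "bounded (f' ` \<Omega>)" by (blast intro: compact_imp_bounded)+
  then obtain F M where F: "\<And>y. y \<in> \<Omega> \<Longrightarrow> \<bar>f y\<bar> \<le> F" and M: "\<And>y. y \<in> \<Omega> \<Longrightarrow> norm (f' y) \<le> M"
    unfolding bounded_iff ball_simps real_norm_def by blast

  \<comment> \<open>Compactness of \<open>\<Omega>\<close> bounds the gradient of \<open>f\<close>, the violation bounds the feasibility steps, and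
    together they bound the steps \<open>d k\<close>.\<close>
  have "\<exists>R\<ge>0. \<forall>k. norm (d k) \<le> R"
  proof -
    define D where "D = sqrt (2 * V / b1)"
    have dfea: "norm (dfea k) \<le> D" for k
    proof -
      have "0 \<le> lin_violation h G (x k) (d k)"
        by (simp add: lin_violation_def l1_norm_nonneg)
      then have "vdec k \<le> V"
        using V [of k] abs_ge_self [of "v k"] by (simp add: vdec_def violation_decrease_def lin_violation_0 v_def)
      then have "(norm (dfea k))\<^sup>2 \<le> 2 * V / b1"
        using dfea_vdec [of k] A3(1) by (simp add: field_simps)
      then show ?thesis unfolding D_def by (rule real_le_rsqrt)
    qed
    have grad: "norm (\<rho> k *\<^sub>R grad f (x k)) \<le> P * M" for k
    proof -
      have "norm (grad f (x k)) * norm (grad f (x k)) = f' (x k) (grad f (x k))"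
        using grad_inner_eq [OF f'(1), of "x k" "grad f (x k)"]
        by (simp flip: power2_eq_square power2_norm_eq_inner)
      also have "\<dots> \<le> M * norm (grad f (x k))"
        using norm_blinfun [of "f' (x k)" "grad f (x k)"] mult_right_mono [OF M [OF A2(3), of k], of "norm (grad f (x k))"]
        by simp
      finally have "norm (grad f (x k)) \<le> M"
        using order_trans [OF norm_ge_zero M [OF A2(3), of k]] by (cases "grad f (x k) = 0") auto
      then show ?thesis using P(2) [of k] by (simp add: mult_mono)
    qed
    have "norm (d k) \<le> max 1 (2 * (P * M + P * M * D + b2 * D\<^sup>2 / 2) / b1)" for k
      by (rule opt_solution_norm_le [OF iter(4) opt_feas(2) A3(1) _ _ grad dfea b2])
         (use A3(3,4) in \<open>auto\<close>)
    then show ?thesis by (meson le_max_iff_disj zero_le_one)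
  qed
  then obtain R where R: "0 \<le> R" "\<And>k. norm (d k) \<le> R" by blast

  obtain j where j: "\<And>k. sufficient_decrease f h G \<eta> (\<rho> (Suc k)) (x k) (d k) (\<gamma> ^ j k)"
    "\<And>k. \<forall>i<j k. \<not> sufficient_decrease f h G \<eta> (\<rho> (Suc k)) (x k) (d k) (\<gamma> ^ i)"
    "\<And>k. x (Suc k) = x k + (\<gamma> ^ j k) *\<^sub>R d k"
    using iter(7) by metis
  \<comment> \<open>The line search turns a fixed fraction of \<open>\<gamma> ^ j k * pdec k\<close> into an actual decrease of the
    penalty function. As \<open>\<rho>\<close> tends to zero, that decrease is asymptotically a difference of two
    consecutive terms of the convergent sequence \<open>v\<close>.\<close>
  have step_pdec: "(\<lambda>k. \<gamma> ^ j k * pdec k) \<longlonglongrightarrow> 0"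
  proof -
    have "(\<lambda>k. (\<rho> (Suc k) * (2 * F) + (v k - v (Suc k))) / \<eta>) \<longlonglongrightarrow> (0 * (2 * F) + (vlim - vlim)) / \<eta>"
      using v_lim(1) constants(3) unfolding v_def
      by (intro tendsto_intros LIMSEQ_Suc rho_lim) auto
    moreover have "norm (\<gamma> ^ j k * pdec k) \<le> (\<rho> (Suc k) * (2 * F) + (v k - v (Suc k))) / \<eta>" for k
    proof -
      have "\<eta> * (\<gamma> ^ j k * pdec k) \<le> \<rho> (Suc k) * (f (x k) - f (x (Suc k))) + (v k - v (Suc k))"
        using j(1) [of k] unfolding sufficient_decrease_def j(3) [symmetric] penalty_def
        by (simp add: pdec_def v_def algebra_simps)
      also have "\<dots> \<le> \<rho> (Suc k) * (2 * F) + (v k - v (Suc k))"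
        using F [OF A2(3), of k] F [OF A2(3), of "Suc k"] rho_nonneg [of "Suc k"]
        by (intro add_right_mono mult_left_mono) auto
      finally show ?thesis
        using constants(3,4) pdec_nonneg [of k] by (simp add: field_simps)
    qed
    ultimately show ?thesis
      by (intro Lim_null_comparison [of "\<lambda>k. \<gamma> ^ j k * pdec k"] always_eventually) auto
  qed

  \<comment> \<open>The step lengths cannot be responsible for the convergence to zero: they are bounded below
    wherever \<open>pdec\<close> is.\<close>
  have "(\<lambda>i. pdec (\<phi> i)) \<longlonglongrightarrow> 0"
  proof (rule LIMSEQ_I)
    fix c :: real assume "0 < c"
    obtain \<tau> where \<tau>: "0 < \<tau>" "\<forall>\<^sub>F y in nhds xstar. \<forall>d \<rho> u. norm d \<le> R \<longrightarrow> 0 \<le> \<rho> \<longrightarrow> \<rho> \<le> P \<longrightarrow>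
        c \<le> penalty_decrease f h G \<rho> y d \<longrightarrow> 0 \<le> u \<longrightarrow> u \<le> \<tau> \<longrightarrow> sufficient_decrease f h G \<eta> \<rho> y d u"
      using short_steps_accepted [OF A1 G_symmetric \<open>0 < c\<close> _ R(1) P(1), of \<eta> xstar] constants(3)
      by auto
    have "\<forall>\<^sub>F i in sequentially. c \<le> pdec (\<phi> i) \<longrightarrow> min 1 (\<gamma> * \<tau>) \<le> \<gamma> ^ j (\<phi> i)"
      using eventually_compose_filterlim [OF \<tau>(2) accumulation(3)]
    proof eventually_elim
      case (elim i)
      show ?case
      proof
        assume "c \<le> pdec (\<phi> i)"
        then show "min 1 (\<gamma> * \<tau>) \<le> \<gamma> ^ j (\<phi> i)"
          using elim R(2) rho_nonneg abs_le_D1 [OF P(2)] constants(4)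
          by (intro backtracking_step_ge [OF _ _ j(2)]) (auto simp: pdec_def)
      qed
    qed
    moreover have "0 < min 1 (\<gamma> * \<tau>) * c" using \<tau>(1) constants(4) \<open>0 < c\<close> by simp
    then have "\<forall>\<^sub>F i in sequentially. \<gamma> ^ j (\<phi> i) * pdec (\<phi> i) < min 1 (\<gamma> * \<tau>) * c"
      using LIMSEQ_subseq_LIMSEQ [OF step_pdec accumulation(1)] unfolding comp_def
      by (rule order_tendstoD(2) [rotated])
    ultimately have "\<forall>\<^sub>F i in sequentially. norm (pdec (\<phi> i) - 0) < c"
    proof eventually_elim
      case (elim i)
      have "pdec (\<phi> i) < c"
      proof (rule ccontr)
        assume "\<not> pdec (\<phi> i) < c"
        then have "min 1 (\<gamma> * \<tau>) * c \<le> \<gamma> ^ j (\<phi> i) * pdec (\<phi> i)"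
          using elim(1) \<tau>(1) constants(4) \<open>0 < c\<close> by (intro mult_mono) auto
        then show False using elim(2) by simp
      qed
      then show ?case using pdec_nonneg [of "\<phi> i"] by simp
    qed
    then show "\<exists>N. \<forall>i\<ge>N. norm (pdec (\<phi> i) - 0) < c" by (simp add: eventually_sequentially)
  qed
  have "(\<lambda>i. dfea (\<phi> i)) \<longlonglongrightarrow> 0"
  proof -
    have "(norm (dfea k))\<^sup>2 \<le> 2 / (b1 * \<epsilon>) * pdec k" for k
    proof -
      have "\<epsilon> * (b1 / 2 * (norm (dfea k))\<^sup>2) \<le> pdec k"
        by (rule order_trans [OF mult_left_mono [OF dfea_vdec] vdec_pdec]) (use constants(1) in auto)
      then show ?thesis using A3(1) constants(1) by (simp add: field_simps)
    qed
    then have "norm ((norm (dfea (\<phi> i)))\<^sup>2) \<le> 2 / (b1 * \<epsilon>) * pdec (\<phi> i)" for i by simp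
    moreover have "(\<lambda>i. 2 / (b1 * \<epsilon>) * pdec (\<phi> i)) \<longlonglongrightarrow> 0"
      using tendsto_mult_left [OF \<open>(\<lambda>i. pdec (\<phi> i)) \<longlonglongrightarrow> 0\<close>, of "2 / (b1 * \<epsilon>)"] by simp
    ultimately have "(\<lambda>i. (norm (dfea (\<phi> i)))\<^sup>2) \<longlonglongrightarrow> 0"
      by (intro Lim_null_comparison [of "\<lambda>i. (norm (dfea (\<phi> i)))\<^sup>2"] always_eventually) auto
    from tendsto_real_sqrt [OF this] show ?thesis by (simp add: tendsto_norm_zero_iff)
  qed
  moreover have "violation h G xstar > 0"
  proof -
    have "isCont (violation h G) xstar"
      by (intro isCont_violation G_symmetric has_derivative_continuous [OF h'(1)]
          has_derivative_continuous [OF G'(1)])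
    then have "(\<lambda>i. violation h G (x (\<phi> i))) \<longlonglongrightarrow> violation h G xstar"
      using accumulation(3) by (rule isCont_tendsto_compose)
    moreover have "(\<lambda>i. violation h G (x (\<phi> i))) \<longlonglongrightarrow> vlim"
      using LIMSEQ_subseq_LIMSEQ [OF v_lim(1) accumulation(1)] by (simp add: comp_def)
    ultimately show ?thesis using LIMSEQ_unique v_lim(2) by blast
  qed
  ultimately have "infeasible_stationary h G xstar"
    by (rule vanishing_feasibility_steps_imp_infeasible_stationary [OF A1(2,3) G_symmetric
        accumulation(3) _ _ iter(2) iter(3) psd_Bfea _ b2]) (use A3(3) in blast)
  then show ?thesis
    using infeasible_stationary_imp_fritz_john [of G xstar] infeasible_stationary_imp_not_robinson
      G_symmetric by blast
qed

end
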